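(* Let $m\ge 1$, and let $D=(d_{ij})_{1\le i,j\le m}$ be a constant real matrix which is monotone, irreducible, and has a row all of whose entries are nonzero (i.e. there exists $i$ such that $d_{ij}\neq 0$ for all $j=1,\dots,m$). Let $H_i\in C(\mathbb{T}^N\times\mathbb{R}^N)$ and $u_{0i}\in C(\mathbb{T}^N)$, $i=1,\dots,m$. Assume that the system $$\frac{\partial u_i}{\partial t}+H_i(x,Du_i)+\sum_{j=1}^m d_{ij}u_j=0 \ \text{ in } \mathbb{T}^N\times(0,\infty),\qquad u_i(x,0)=u_{0i}(x)\ \text{ on } \mathbb{T}^N,\qquad i=1,\dots,m, \tag{E}$$ has a unique solution $u=(u_1,\dots,u_m)$ and that $u\in W^{1,\infty}(\mathbb{T}^N\times(0,\infty))^m$. Assume also that the stationary system $$H_i(x,Dv_i)+\sum_{j=1}^m d_{ij}v_j=0\ \text{ in }\mathbb{T}^N,\qquad i=1,\dots,m, \tag{S}$$ has a solution $v\in W^{1,\infty}(\mathbb{T}^N)^m$. Suppose that there are a (possibly empty) compact set $K\subset\mathbb{T}^N$ and, for each $\eta>0$, a constant $\psi(\eta)>0$ depending only on $\eta$, such that for every $i=1,\dots,m$: (i) the function $p\mapsto H_i(x,p)$ is differentiable for a.e. $x\in\mathbb{T}^N$; (ii) $(H_i)_p(x,p)\cdot p-H_i(x,p)\ge 0$ for a.e. $(x,p)\in\mathbb{T}^N\times\mathbb{R}^N$; (iii)(a) $H_i(x,p)\ge 0$ for all $(x,p)\in K\times\mathbb{R}^N$; (iii)(b) if $\eta>0$,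 $H_i(x,p)\ge\eta$ and $\operatorname{dist}(x,K)\ge\eta$, then $(H_i)_p(x,p)\cdot p-H_i(x,p)\ge\psi(\eta)$ (the gradient being understood where it exists). Then, as $t\to\infty$, $u(\cdot,t)$ converges uniformly on $\mathbb{T}^N$ to a solution $(v_{\infty 1},\dots,v_{\infty m})$ of (S).
   Context: $\mathbb{T}^N$ is the $N$-dimensional flat torus. All solutions are understood in the viscosity sense. $W^{1,\infty}$ denotes bounded Lipschitz continuous functions; $X^m$ denotes vector functions $(u_1,\dots,u_m)$ with each component in $X$. $(H_i)_p$ is the gradient of $H_i$ in $p$. $\operatorname{dist}(x,K)$ is the usual distance, equal to $+\infty$ if $K=\emptyset$. $D$ is monotone if $d_{ii}\ge 0$ for all $i$, $d_{ij}\le 0$ for $i\ne j$, and $\sum_{j=1}^m d_{ij}=0$ for all $i$. $D$ is irreducible if for every (nonempty) proper subset $\mathcal{I}\subsetneq\{1,\dots,m\}$ there exist $i\in\mathcal{I}$ and $j\notin\mathcal{I}$ with $d_{ij}\ne 0$. *)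

theory Defs
  imports "HOL-Analysis.Analysis"
begin

text \<open>
  The flat torus is R^N / Z^N, with N the cardinality of the index type. Functions on the torus
  are identified with the functions on R^N that are periodic with respect to Z^N, and subsets of
  the torus with the Z^N-invariant subsets of R^N. Under this identification compact sets
  are the closed invariant sets, the distance in the torus from a point to a set is the Euclidean
  distance to the invariant set, and a function is L-Lipschitz on the torus if and only if its
  periodic lift is L-Lipschitz on R^N.
\<close>

definition periodic :: "(real^'n \<Rightarrow> 'b) \<Rightarrow> bool" where
  "periodic f \<longleftrightarrow> (\<forall>x k. (\<forall>l. k $ l \<in> \<int>) \<longrightarrow> f (x + k) = f x)"

definition torus_compact :: "(real^'n) set \<Rightarrow> bool" where
  "torus_compact K \<longleftrightarrow> closed K \<and> periodic (\<lambda>x. x \<in> K)"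

text \<open>Extended-real valued, so that the distance to the empty set is infinite
  (in contrast to \<open>infdist\<close>, which is then zero).\<close>

definition set_dist :: "'a::metric_space \<Rightarrow> 'a set \<Rightarrow> ereal" where
  "set_dist x K = (INF y\<in>K. ereal (dist x y))"

definition W1_inf_on :: "'a::metric_space set \<Rightarrow> ('a \<Rightarrow> real) \<Rightarrow> bool" where
  "W1_inf_on S f \<longleftrightarrow> bounded (f ` S) \<and> (\<exists>L. L-lipschitz_on S f)"

definition monotone_matrix :: "real^'m^'m \<Rightarrow> bool" where
  "monotone_matrix D \<longleftrightarrow>
     (\<forall>i. 0 \<le> D $ i $ i) \<and> (\<forall>i j. i \<noteq> j \<longrightarrow> D $ i $ j \<le> 0) \<and> (\<forall>i. (\<Sum>j\<in>UNIV. D $ i $ j) = 0)"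

definition irreducible_matrix :: "real^'m^'m \<Rightarrow> bool" where
  "irreducible_matrix D \<longleftrightarrow>
     (\<forall>I. I \<noteq> {} \<and> I \<noteq> UNIV \<longrightarrow> (\<exists>i\<in>I. \<exists>j. j \<notin> I \<and> D $ i $ j \<noteq> 0))"

definition C1_on :: "'a::real_inner set \<Rightarrow> ('a \<Rightarrow> real) \<Rightarrow> ('a \<Rightarrow> 'a) \<Rightarrow> bool" where
  "C1_on S \<phi> G \<longleftrightarrow> (\<forall>y\<in>S. GDERIV \<phi> y :> G y) \<and> continuous_on S G"

text \<open>
  Viscosity solutions of a weakly coupled system F i y (u y) (D u_i y) = 0, one equation for each
  index i, in an open set \<open>\<Omega>\<close>. The component u_i is tested from above (below) at a local
  maximum (minimum) point y by functions \<open>\<phi>\<close> of class C^1 near y, with \<open>S\<close> the neighbourhood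
  of y on which u_i - \<open>\<phi>\<close> is extremal at y. The coupling uses the values of all
  components of u at y. Since the notion is local, periodic functions on R^N
  satisfy it exactly when the corresponding functions on the torus do: a neighbourhood of a
  point of R^N serves as a chart of the torus, and \<open>\<phi>\<close> need not be periodic.
\<close>

definition viscosity_subsolution ::
  "'a::real_inner set \<Rightarrow> ('m \<Rightarrow> 'a \<Rightarrow> real^'m \<Rightarrow> 'a \<Rightarrow> real) \<Rightarrow> ('a \<Rightarrow> real^'m) \<Rightarrow> bool" where
  "viscosity_subsolution \<Omega> F u \<longleftrightarrow>
     (\<forall>i S \<phi> G y. open S \<and> S \<subseteq> \<Omega> \<and> y \<in> S \<and> C1_on S \<phi> G \<and>
        (\<forall>z\<in>S. u z $ i - \<phi> z \<le> u y $ i - \<phi> y) \<longrightarrow> F i y (u y) (G y) \<le> 0)"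

definition viscosity_supersolution ::
  "'a::real_inner set \<Rightarrow> ('m \<Rightarrow> 'a \<Rightarrow> real^'m \<Rightarrow> 'a \<Rightarrow> real) \<Rightarrow> ('a \<Rightarrow> real^'m) \<Rightarrow> bool" where
  "viscosity_supersolution \<Omega> F u \<longleftrightarrow>
     (\<forall>i S \<phi> G y. open S \<and> S \<subseteq> \<Omega> \<and> y \<in> S \<and> C1_on S \<phi> G \<and>
        (\<forall>z\<in>S. u y $ i - \<phi> y \<le> u z $ i - \<phi> z) \<longrightarrow> 0 \<le> F i y (u y) (G y))"

definition viscosity_solution ::
  "'a::real_inner set \<Rightarrow> ('m \<Rightarrow> 'a \<Rightarrow> real^'m \<Rightarrow> 'a \<Rightarrow> real) \<Rightarrow> ('a \<Rightarrow> real^'m) \<Rightarrow> bool" where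
  "viscosity_solution \<Omega> F u \<longleftrightarrow>
     continuous_on \<Omega> u \<and> viscosity_subsolution \<Omega> F u \<and> viscosity_supersolution \<Omega> F u"

definition stationary_solution ::
  "('m \<Rightarrow> real^'n \<Rightarrow> real^'n \<Rightarrow> real) \<Rightarrow> real^'m^'m \<Rightarrow> (real^'n \<Rightarrow> real^'m) \<Rightarrow> bool" where
  "stationary_solution H D v \<longleftrightarrow>
     periodic v \<and>
     viscosity_solution UNIV (\<lambda>i x r p. H i x p + (\<Sum>j\<in>UNIV. D $ i $ j * r $ j)) v"

text \<open>
  In the evolution system the gradient of a test function at (x, t) is the pair (p, a) of its
  spatial gradient and its time derivative. Only the values of u at times
  \<open>t \<ge> 0\<close> are meaningful.
\<close>

definition evolution_solution ::
  "('m \<Rightarrow> real^'n \<Rightarrow> real^'n \<Rightarrow> real) \<Rightarrow> real^'m^'m \<Rightarrow> (real^'n \<Rightarrow> real^'m) \<Rightarrow>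
   ((real^'n) \<times> real \<Rightarrow> real^'m) \<Rightarrow> bool" where
  "evolution_solution H D u0 u \<longleftrightarrow>
     (\<forall>t\<ge>0. periodic (\<lambda>x. u (x, t))) \<and>
     continuous_on (UNIV \<times> {0..}) u \<and>
     viscosity_solution (UNIV \<times> {0<..})
       (\<lambda>i (x, t) r (p, a). a + H i x p + (\<Sum>j\<in>UNIV. D $ i $ j * r $ j)) u \<and>
     (\<forall>x. u (x, 0) = u0 x)"

end

theory Submission
  imports Defs "HOL-Complex_Analysis.Great_Picard"
begin

text \<open>
  Integrating (i)--(iii) along rays gives H_i(x, l p) \<open>\<ge>\<close> l H_i(x, p) for l \<open>\<ge>\<close> 1, strictly if
  H_i(x, p) > 0 and x is not in K. Let \<open>\<eta>\<close> > 0 and shift u by a constant so that it is positive. The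
  best l \<open>\<le>\<close> 1 such that u_i(x, s) + \<open>\<eta>\<close> (s - t) \<open>\<ge>\<close> l u_i(x, t) for all large t \<open>\<le>\<close> s is attained with
  equality by a limit w of time translates of u, which is a solution for all times in \<open>\<real>\<close>. If l < 1,
  doubling the space variable at a contact point (x, t, s) and irreducibility of D show that all
  components are in contact there. For the component i with the smallest w_i(x, s) the equation gives
  H_i \<open>\<ge>\<close> \<open>\<eta>\<close> at the contact point. This contradicts the strict inequality if x is not in K. If x is in K,
  then H_i \<open>\<ge>\<close> 0 makes the largest component of u(x, .) nonincreasing, so that of w(x, .) is
  constant; by irreducibility w(x, .) is a constant vector, which is incompatible with contact. Hence
  l = 1 for every \<open>\<eta>\<close>, every limit w is nondecreasing in time and converges to a stationary
  solution, and the comparison principle turns this into convergence of u.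
\<close>

subsection \<open>Superhomogeneity of the Hamiltonians\<close>

text \<open>The term \<open>\<eta> * (s - t)\<close> has two jobs. It enters both equations at a
  contact point, so that the Hamiltonian there is at least \<eta> and not merely nonnegative; and it
  bounds \<open>s - t\<close> for pairs violating the inequality, so that these pairs converge along
  translates. Shifting u is harmless because the rows of D sum to zero.

  Contact has to spread to all components because the sign of the coupling term is known only for
  the smallest component of w(x, s), and the component first found in contact may be another one.

  The regularity of H shapes the rest. Differentiability and (ii) hold only almost everywhere,
  whereas a viscosity solution is tested at prescribed points. They are therefore used only after
  integration, as inequalities between continuous functions, which extend to every point. In the
  doubling argument continuity of H gives no control over large gradients; the Lipschitz bound on u
  keeps the penalized gradients bounded, so that both equations hold in the limit at the same x and
  with the same vector P.\<close>

lemma AE_closed_imp_all: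
  fixes R :: "'a::euclidean_space \<Rightarrow> bool"
  assumes "closed {x. R x}" and "AE x in lborel. R x"
  shows "R x"
proof (rule ccontr)
  assume "\<not> R x"
  then have ne: "{x. \<not> R x} \<noteq> {}" by auto
  have op: "open {x. \<not> R x}"
    using assms(1) by (simp add: closed_def Collect_neg_eq)
  have "{x. \<not> R x} \<in> null_sets lborel"
    using assms(2) op AE_iff_null_sets[of "{x. \<not> R x}" lborel] by simp
  then have "negligible {x. \<not> R x}"
    by (meson negligible_iff_null_sets null_sets_completionI)
  with open_not_negligible[OF op ne] show False by simp
qed

lemma differentiable_imp_GDERIV:
  fixes f :: "'a::euclidean_space \<Rightarrow> real"
  assumes "f differentiable (at x)"
  obtains q where "GDERIV f x :> q"
proof -
  obtain f' where f': "(f has_derivative f') (at x)"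
    using assms by (auto simp: differentiable_def)
  then have "linear f'" by (rule has_derivative_linear)
  then have "f' = (\<lambda>h. h \<bullet> adjoint f' 1)"
    using adjoint_works[of f' _ 1] by auto
  with f' that show ?thesis unfolding gderiv_def by metis
qed

text \<open>Up to the factor \<open>1 / s\<^sup>2\<close>, the derivative of
  \<open>f (s *\<^sub>R p) / s\<close> is the expression of hypothesis (ii) at the point
  \<open>s *\<^sub>R p\<close>. This is why (ii) amounts to superhomogeneity.\<close>

lemma GDERIV_ray_quotient:
  assumes "GDERIV f (s *\<^sub>R p) :> q" and "s \<noteq> 0"
  shows "((\<lambda>s. f (s *\<^sub>R p) / s) has_real_derivative (q \<bullet> (s *\<^sub>R p) - f (s *\<^sub>R p)) / s\<^sup>2) (at s)"
proof -
  have d: "((\<lambda>s. s *\<^sub>R p) has_derivative (\<lambda>h. h *\<^sub>R p)) (at s)"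
    by (auto intro!: derivative_eq_intros)
  have "((\<lambda>s. f (s *\<^sub>R p)) has_derivative (\<lambda>h. (h *\<^sub>R p) \<bullet> q)) (at s)"
    using has_derivative_compose[OF d, of f "\<lambda>h. h \<bullet> q"] assms(1) by (simp add: gderiv_def)
  then have D: "((\<lambda>s. f (s *\<^sub>R p)) has_real_derivative p \<bullet> q) (at s)"
    by (simp add: has_field_derivative_def mult.commute[of _ "p \<bullet> q"])
  show ?thesis
    using assms(2)
    by (auto intro!: derivative_eq_intros D simp: inner_commute power2_eq_square)
qed

text \<open>The derivative need only be nonnegative almost everywhere because it is gauge integrable.\<close>

lemma DERIV_AE_nonneg_imp_le:
  fixes f f' :: "real \<Rightarrow> real"
  assumes "a \<le> b"
    and f': "\<And>s. s \<in> {a..b} \<Longrightarrow> (f has_real_derivative f' s) (at s)"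
    and ae: "AE s in lborel. s \<in> {a..b} \<longrightarrow> 0 \<le> f' s"
  shows "f a \<le> f b"
proof -
  have I: "(f' has_integral f b - f a) {a..b}"
    using assms(1) f'
    by (intro fundamental_theorem_of_calculus)
       (auto simp: has_real_derivative_iff_has_vector_derivative[symmetric] intro: DERIV_subset)
  obtain N where N: "N \<in> null_sets lborel" "{s. \<not> (s \<in> {a..b} \<longrightarrow> 0 \<le> f' s)} \<subseteq> N"
    using ae by (auto simp: eventually_ae_filter)
  have "negligible N"
    using N(1) by (meson negligible_iff_null_sets null_sets_completionI)
  then have "((\<lambda>s. max 0 (f' s)) has_integral f b - f a) {a..b}"
    using N(2) by (intro has_integral_spike[OF _ _ I]) (auto simp: max_def)
  then have "0 \<le> f b - f a"
    by (rule has_integral_nonneg) auto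
  then show ?thesis by simp
qed

text \<open>A single ray is a null set, so (ii) says nothing about an individual one. Scaling p by a
  fixed nonzero s preserves null sets, however, and Fubini's theorem then makes Q hold almost
  everywhere on almost every ray.\<close>

lemma AE_scale_snd:
  fixes Q :: "'a::euclidean_space \<times> 'b::euclidean_space \<Rightarrow> bool"
  assumes "AE z in lborel. Q z"
  shows "AE z in lborel. AE s in lborel. s \<noteq> 0 \<longrightarrow> Q (fst z, s *\<^sub>R snd z)"
proof -
  obtain N where N: "N \<in> null_sets lborel" "{z. \<not> Q z} \<subseteq> N"
    using assms by (auto simp: eventually_ae_filter)
  let ?h = "\<lambda>(z :: 'a \<times> 'b) (s::real). (fst z, s *\<^sub>R snd z)"
  have [measurable]: "N \<in> sets borel" using N(1) by auto
  have *: "AE z in lborel. s \<noteq> 0 \<longrightarrow> ?h z s \<notin> N" for s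
  proof (cases "s = 0")
    case False
    have lin: "linear (\<lambda>z :: 'a \<times> 'b. (fst z, (1 / s) *\<^sub>R snd z))"
      by (rule linearI) (auto simp: scaleR_add_right)
    have "negligible N"
      using N(1) by (meson negligible_iff_null_sets null_sets_completionI)
    then have "negligible ((\<lambda>z. (fst z, (1 / s) *\<^sub>R snd z)) ` N)"
      using lin by (intro negligible_differentiable_image_negligible linear_imp_differentiable_on) auto
    moreover have "{z. ?h z s \<in> N} \<subseteq> (\<lambda>z. (fst z, (1 / s) *\<^sub>R snd z)) ` N"
      using False by (force simp: image_iff)
    ultimately have neg: "negligible {z. ?h z s \<in> N}"
      by (rule negligible_subset)
    have "(\<lambda>z. ?h z s) \<in> borel_measurable borel"
      by (intro borel_measurable_continuous_onI continuous_intros)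
    then have "{z. ?h z s \<in> N} \<in> sets borel"
      by measurable
    then have "{z. ?h z s \<in> N} \<in> null_sets lborel"
      using neg by (simp add: negligible_iff_null_sets null_sets_completion_iff)
    then show ?thesis
      using AE_not_in by fastforce
  qed simp
  have "AE z in lborel. AE s in lborel. s \<noteq> 0 \<longrightarrow> ?h z s \<notin> N"
  proof (subst lborel_pair.AE_commute)
    show "{x \<in> space (lborel \<Otimes>\<^sub>M lborel). snd x \<noteq> 0 \<longrightarrow> ?h (fst x) (snd x) \<notin> N}
      \<in> sets (lborel \<Otimes>\<^sub>M lborel)"
    proof -
      have "(\<lambda>x. ?h (fst x) (snd x)) \<in> borel_measurable borel"
        by (intro borel_measurable_continuous_onI continuous_intros)
      then have "(\<lambda>x. ?h (fst x) (snd x)) \<in> borel_measurable (lborel \<Otimes>\<^sub>M lborel)"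
        by (simp add: lborel_prod)
      then show ?thesis by measurable
    qed
  qed (use * in auto)
  then show ?thesis
  proof eventually_elim
    case (elim z)
    then show ?case
      by eventually_elim (use N(2) in auto)
  qed
qed

lemma hamiltonian_superhomogeneous:
  fixes F :: "'a::euclidean_space \<Rightarrow> 'b::euclidean_space \<Rightarrow> real"
  assumes cont: "continuous_on UNIV (\<lambda>(x, p). F x p)"
    and diff: "AE x in lebesgue. \<forall>p. F x differentiable (at p)"
    and ii: "AE (x, p) in lebesgue. \<exists>q. (GDERIV (F x) p :> q) \<and> q \<bullet> p - F x p \<ge> 0"
    and l: "1 \<le> l"
  shows "l * F x p \<le> F x (l *\<^sub>R p)"
proof -
  let ?Q = "\<lambda>z. \<exists>q. (GDERIV (F (fst z)) (snd z) :> q) \<and> q \<bullet> (snd z) - F (fst z) (snd z) \<ge> 0"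
  have cF: "continuous_on UNIV (\<lambda>z. F (g z) (h z))"
    if "continuous_on UNIV g" "continuous_on UNIV h" for g :: "'c::topological_space \<Rightarrow> 'a" and h
    using continuous_on_compose2[OF cont, of UNIV "\<lambda>z. (g z, h z)"] that
    by (auto intro: continuous_intros)
  have "AE z in lborel. ?Q z"
    using ii by (simp add: AE_completion_iff case_prod_beta)
  then have "AE z in lborel \<Otimes>\<^sub>M lborel. AE s in lborel. s \<noteq> 0 \<longrightarrow> ?Q (fst z, s *\<^sub>R snd z)"
    using AE_scale_snd[of ?Q] unfolding lborel_prod by simp
  then have "AE x in lborel. AE p in lborel. AE s in lborel. s \<noteq> 0 \<longrightarrow> ?Q (x, s *\<^sub>R p)"
    using lborel_pair.AE_pair by fastforce
  moreover have "AE x in lborel. \<forall>p. F x differentiable (at p)"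
    using diff by (simp add: AE_completion_iff)
  ultimately have aex: "AE x in lborel. \<forall>p. l * F x p \<le> F x (l *\<^sub>R p)"
  proof eventually_elim
    case (elim x)
    have "AE p in lborel. l * F x p \<le> F x (l *\<^sub>R p)"
      using elim(1)
    proof eventually_elim
      fix p assume ae: "AE s in lborel. s \<noteq> 0 \<longrightarrow> ?Q (x, s *\<^sub>R p)"
      have "\<exists>q. GDERIV (F x) p :> q" for p
        using elim(2) differentiable_imp_GDERIV by metis
      then obtain G where G: "\<And>p. GDERIV (F x) p :> G p"
        by metis
      define f' where "f' s = (G (s *\<^sub>R p) \<bullet> (s *\<^sub>R p) - F x (s *\<^sub>R p)) / s\<^sup>2" for s
      have "F x (1 *\<^sub>R p) / 1 \<le> F x (l *\<^sub>R p) / l"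
      proof (rule DERIV_AE_nonneg_imp_le[where f = "\<lambda>s. F x (s *\<^sub>R p) / s"])
        show "((\<lambda>s. F x (s *\<^sub>R p) / s) has_real_derivative f' s) (at s)"
          if "s \<in> {1..l}" for s
          unfolding f'_def using that by (intro GDERIV_ray_quotient G) auto
        show "AE s in lborel. s \<in> {1..l} \<longrightarrow> 0 \<le> f' s"
          using ae
        proof eventually_elim
          case (elim s)
          show ?case
          proof
            assume s: "s \<in> {1..l}"
            then obtain q where q: "GDERIV (F x) (s *\<^sub>R p) :> q"
              "0 \<le> (q \<bullet> (s *\<^sub>R p) - F x (s *\<^sub>R p)) / s\<^sup>2"
              using elim by fastforce
            have "f' s = (q \<bullet> (s *\<^sub>R p) - F x (s *\<^sub>R p)) / s\<^sup>2"
              using s unfolding f'_def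
              by (intro DERIV_unique[OF GDERIV_ray_quotient GDERIV_ray_quotient] G q) auto
            with q(2) show "0 \<le> f' s" by simp
          qed
        qed
      qed (use l in auto)
      then show "l * F x p \<le> F x (l *\<^sub>R p)"
        using l by (simp add: field_simps)
    qed
    \<comment> \<open>The exceptional p are removed here for fixed x; the exceptional x are removed
      at the end in the same way.\<close>
    moreover have "closed {p. l * F x p \<le> F x (l *\<^sub>R p)}"
      by (intro closed_Collect_le cF continuous_intros)
    ultimately show ?case
      using AE_closed_imp_all by blast
  qed
  have "AE x in lborel. l * F x p \<le> F x (l *\<^sub>R p)"
    using aex by eventually_elim auto
  moreover have "closed {x. l * F x p \<le> F x (l *\<^sub>R p)}"
    by (intro closed_Collect_le cF continuous_intros)
  ultimately show ?thesis
    using AE_closed_imp_all by blast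
qed

text \<open>Differentiability may fail at x0 itself, and a strict inequality at nearby points could
  degenerate in the limit. Integrating (iii)(b) along the ray yields the gap
  \<open>\<psi> \<eta> * (l - 1)\<close>, which is the same for all x near x0 and therefore
  survives.\<close>

lemma hamiltonian_strictly_superhomogeneous:
  fixes F :: "'a::euclidean_space \<Rightarrow> 'b::euclidean_space \<Rightarrow> real"
  assumes cont: "continuous_on UNIV (\<lambda>(x, p). F x p)"
    and diff: "AE x in lebesgue. \<forall>p. F x differentiable (at p)"
    and hom: "\<And>x p l. 1 \<le> l \<Longrightarrow> l * F x p \<le> F x (l *\<^sub>R p)"
    and strict: "\<And>x p q \<eta>. \<eta> > 0 \<Longrightarrow> F x p \<ge> \<eta> \<Longrightarrow> set_dist x K \<ge> ereal \<eta> \<Longrightarrow>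
      GDERIV (F x) p :> q \<Longrightarrow> q \<bullet> p - F x p \<ge> \<psi> \<eta>"
    and \<psi>: "\<And>\<eta>. \<eta> > 0 \<Longrightarrow> \<psi> \<eta> > 0"
    and K: "closed K" "x0 \<notin> K" and pos: "F x0 p > 0" and l: "1 < l"
  shows "l * F x0 p < F x0 (l *\<^sub>R p)"
proof -
  have cF: "continuous_on UNIV (\<lambda>z. F z (c *\<^sub>R p))" for c
    using continuous_on_compose2[OF cont continuous_on_Pair[OF continuous_on_id continuous_on_const]]
    by auto
  obtain \<rho> where \<rho>: "\<rho> > 0" "\<And>y. y \<in> K \<Longrightarrow> 2 * \<rho> \<le> dist x0 y"
  proof -
    obtain e where "e > 0" "ball x0 e \<subseteq> - K"
      using K open_contains_ball[of "- K"] by (auto simp: open_Compl)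
    then show ?thesis
      using that[of "e / 2"] by (force simp: mem_ball not_less[symmetric])
  qed
  \<comment> \<open>Half of \<open>F x0 p\<close> makes \<open>\<eta> < F x p\<close> an open
    condition that holds at x0. Since \<rho> is at most half the distance from x0 to K, the points
    of \<open>ball x0 \<rho>\<close> still have distance at least \<rho> from K.\<close>
  define \<eta> where "\<eta> = min (F x0 p / 2) \<rho>"
  have \<eta>: "\<eta> > 0" "\<eta> < F x0 p" "\<eta> \<le> \<rho>"
    using pos \<rho>(1) by (auto simp: \<eta>_def)
  define W where "W = ball x0 \<rho> \<inter> {x. \<eta> < F x p}"
  have "open W"
    unfolding W_def using cF[of 1] by (intro open_Int open_ball open_Collect_less) auto
  have far: "ereal \<eta> \<le> set_dist x K" if "x \<in> W" for x
    unfolding set_dist_def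
  proof (rule INF_greatest)
    fix y assume "y \<in> K"
    then have "2 * \<rho> \<le> dist x0 y" by (rule \<rho>(2))
    moreover have "dist x0 x < \<rho>" using that by (simp add: W_def)
    ultimately have "\<rho> \<le> dist x y"
      using dist_triangle[of x0 y x] by linarith
    with \<eta> show "ereal \<eta> \<le> ereal (dist x y)" by simp
  qed
  have "AE x in lborel. \<forall>p. F x differentiable (at p)"
    using diff by (simp add: AE_completion_iff)
  then have "AE x in lborel. x \<notin> W \<or> l * F x p + \<psi> \<eta> * (l - 1) \<le> F x (l *\<^sub>R p)"
  proof eventually_elim
    case (elim x)
    show ?case
    proof (cases "x \<in> W")
      case True
      have "\<exists>q. GDERIV (F x) p :> q" for p
        using elim differentiable_imp_GDERIV by metis
      then obtain G where G: "\<And>p. GDERIV (F x) p :> G p"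
        by metis
      \<comment> \<open>The derivative of \<open>\<psi> \<eta> / s\<close> cancels the lower bound
        \<open>\<psi> \<eta> / s\<^sup>2\<close> for the derivative of the quotient, so the gap
        becomes plain monotonicity in s.\<close>
      have D: "((\<lambda>s. F x (s *\<^sub>R p) / s + \<psi> \<eta> / s) has_real_derivative
          (G (s *\<^sub>R p) \<bullet> (s *\<^sub>R p) - F x (s *\<^sub>R p)) / s\<^sup>2 + (- \<psi> \<eta> / s\<^sup>2)) (at s)"
        if "s \<ge> 1" for s
        using that
        by (intro DERIV_add GDERIV_ray_quotient G)
           (auto intro!: derivative_eq_intros simp: power2_eq_square)
      have nn: "0 \<le> (G (s *\<^sub>R p) \<bullet> (s *\<^sub>R p) - F x (s *\<^sub>R p)) / s\<^sup>2 + (- \<psi> \<eta> / s\<^sup>2)"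
        if "s \<ge> 1" for s
      proof -
        \<comment> \<open>Superhomogeneity keeps the Hamiltonian above \<eta> along the whole ray,
          so (iii)(b) applies at each of its points.\<close>
        have "1 * \<eta> \<le> s * F x p"
          using that True \<eta> by (intro mult_mono) (auto simp: W_def)
        also have "\<dots> \<le> F x (s *\<^sub>R p)" by (rule hom[OF that])
        finally have "\<eta> \<le> F x (s *\<^sub>R p)" by simp
        then have "\<psi> \<eta> \<le> G (s *\<^sub>R p) \<bullet> (s *\<^sub>R p) - F x (s *\<^sub>R p)"
          by (rule strict[OF \<eta>(1) _ far[OF True] G])
        then have "0 \<le> (G (s *\<^sub>R p) \<bullet> (s *\<^sub>R p) - F x (s *\<^sub>R p) - \<psi> \<eta>) / s\<^sup>2" by simp
        then show ?thesis by (simp add: diff_divide_distrib)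
      qed
      have "F x (1 *\<^sub>R p) / 1 + \<psi> \<eta> / 1 \<le> F x (l *\<^sub>R p) / l + \<psi> \<eta> / l"
        using l by (intro DERIV_nonneg_imp_nondecreasing[where f = "\<lambda>s. F x (s *\<^sub>R p) / s + \<psi> \<eta> / s"])
          (use D nn in \<open>auto intro!: exI\<close>)
      then show ?thesis
        using l by (simp add: field_simps)
    qed auto
  qed
  moreover have "closed {x. x \<notin> W \<or> l * F x p + \<psi> \<eta> * (l - 1) \<le> F x (l *\<^sub>R p)}"
  proof -
    have "closed (- W)" using \<open>open W\<close> by (rule closed_Compl)
    moreover have "closed {x. l * F x p + \<psi> \<eta> * (l - 1) \<le> F x (l *\<^sub>R p)}"
      using cF[of 1] cF[of l] by (intro closed_Collect_le continuous_intros) auto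
    moreover have "{x. x \<notin> W \<or> l * F x p + \<psi> \<eta> * (l - 1) \<le> F x (l *\<^sub>R p)} =
        - W \<union> {x. l * F x p + \<psi> \<eta> * (l - 1) \<le> F x (l *\<^sub>R p)}"
      by auto
    ultimately show ?thesis
      by (metis closed_Un)
  qed
  ultimately have "x0 \<notin> W \<or> l * F x0 p + \<psi> \<eta> * (l - 1) \<le> F x0 (l *\<^sub>R p)"
    by (rule AE_closed_imp_all[rotated])
  moreover have "x0 \<in> W"
    using \<rho> \<eta> by (auto simp: W_def)
  moreover have "0 < \<psi> \<eta> * (l - 1)"
    using \<psi>[OF \<eta>(1)] l by simp
  ultimately show ?thesis by simp
qed

subsection \<open>Viscosity solutions and limits\<close>

lemma lipschitz_pointwise_limit_uniform:
  fixes f :: "nat \<Rightarrow> 'a::metric_space \<Rightarrow> 'b::metric_space"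
  assumes S: "compact S"
    and lip: "\<And>n. L-lipschitz_on UNIV (f n)"
    and lim: "\<And>z. (\<lambda>n. f n z) \<longlonglongrightarrow> g z"
  shows "uniform_limit S f g sequentially"
proof (rule uniform_limitI)
  fix e :: real assume "e > 0"
  have L: "L \<ge> 0" using lip by (rule lipschitz_on_nonneg)
  have fl: "dist (f n x) (f n y) \<le> L * dist x y" for n x y
    using lip by (rule lipschitz_onD) auto
  have gl: "dist (g x) (g y) \<le> L * dist x y" for x y
    using fl by (intro LIMSEQ_le_const2[OF tendsto_dist[OF lim lim]]) auto
  define d where "d = e / (3 * (L + 1))"
  have d: "d > 0" "L * d < e / 3"
    using \<open>e > 0\<close> L by (auto simp: d_def field_simps)
  obtain T where T: "finite T" "S \<subseteq> (\<Union>x\<in>T. ball x d)"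
    using S d(1) unfolding compact_eq_totally_bounded by blast
  have "\<forall>\<^sub>F n in sequentially. \<forall>x\<in>T. dist (f n x) (g x) < e / 3"
    using T(1) \<open>e > 0\<close> tendstoD[OF lim, of "e / 3"] by (auto simp: eventually_ball_finite)
  then show "\<forall>\<^sub>F n in sequentially. \<forall>x\<in>S. dist (f n x) (g x) < e"
  proof eventually_elim
    case (elim n)
    show ?case
    proof
      fix x assume "x \<in> S"
      then obtain y where y: "y \<in> T" "dist y x < d" using T(2) by auto
      then have "L * dist y x \<le> L * d" using L by (intro mult_left_mono) auto
      then have "dist (f n x) (f n y) < e / 3" "dist (g y) (g x) < e / 3"
        using fl[of n x y] gl[of y x] d(2) by (auto simp: dist_commute)
      moreover have "dist (f n y) (g y) < e / 3" using elim y(1) by simp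
      moreover have "dist (f n x) (g x) \<le> dist (f n x) (f n y) + dist (f n y) (g y) + dist (g y) (g x)"
        by (meson add_right_mono dist_triangle order_trans)
      ultimately show "dist (f n x) (g x) < e" by linarith
    qed
  qed
qed

lemma lipschitz_on_limit:
  assumes "\<And>n. L-lipschitz_on UNIV (f n)" and "\<And>z. (\<lambda>n. f n z) \<longlonglongrightarrow> g z"
  shows "L-lipschitz_on UNIV g"
proof (rule lipschitz_onI)
  show "0 \<le> L" using assms(1) by (rule lipschitz_on_nonneg)
  show "dist (g x) (g y) \<le> L * dist x y" for x y
    using lipschitz_onD[OF assms(1)]
    by (intro LIMSEQ_le_const2[OF tendsto_dist[OF assms(2) assms(2)]]) auto
qed

lemma lipschitz_tendsto_diagonal:
  fixes f :: "nat \<Rightarrow> 'a::metric_space \<Rightarrow> 'b::metric_space"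
  assumes lip: "\<And>n. L-lipschitz_on UNIV (f n)"
    and lim: "\<And>z. (\<lambda>n. f n z) \<longlonglongrightarrow> g z" and z: "z \<longlonglongrightarrow> y"
  shows "(\<lambda>n. f n (z n)) \<longlonglongrightarrow> g y"
proof (rule metric_tendsto_imp_tendsto)
  have "(\<lambda>n. L * dist (z n) y + dist (f n y) (g y)) \<longlonglongrightarrow> L * dist y y + dist (g y) (g y)"
    by (intro tendsto_intros z lim)
  then show "(\<lambda>n. L * dist (z n) y + dist (f n y) (g y)) \<longlonglongrightarrow> 0" by simp
  show "\<forall>\<^sub>F n in sequentially. dist (f n (z n)) (g y) \<le> dist (L * dist (z n) y + dist (f n y) (g y)) 0"
  proof (intro always_eventually allI)
    fix n
    have "dist (f n (z n)) (f n y) \<le> L * dist (z n) y"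
      by (rule lipschitz_onD[OF lip]) auto
    then show "dist (f n (z n)) (g y) \<le> dist (L * dist (z n) y + dist (f n y) (g y)) 0"
      using dist_triangle[of "f n (z n)" "g y" "f n y"] by simp
  qed
qed

text \<open>The negated operator is again continuous and invariant under the same translations, so
  each closure property below has to be proved for subsolutions only.\<close>

lemma viscosity_supersolution_uminus:
  "viscosity_supersolution \<Omega> F u \<longleftrightarrow>
    viscosity_subsolution \<Omega> (\<lambda>i z r q. - F i z (- r) (- q)) (\<lambda>z. - u z)"
proof -
  have C1: "C1_on S (\<lambda>x. - \<phi> x) (\<lambda>x. - G x)" if "C1_on S \<phi> G" for S and \<phi> :: "'a \<Rightarrow> real" and G
    using that by (auto simp: C1_on_def intro!: GDERIV_minus continuous_intros)
  show ?thesis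
    unfolding viscosity_supersolution_def viscosity_subsolution_def
  proof (intro iffI allI impI, goal_cases)
    case (1 i S \<phi> G y)
    then have "\<forall>z\<in>S. u y $ i + \<phi> y \<le> u z $ i + \<phi> z" by force
    with 1 show ?case
      using C1[of S \<phi> G] 1(1)[rule_format, of S y "\<lambda>x. - \<phi> x" "\<lambda>x. - G x" i] by auto
  next
    case (2 i S \<phi> G y)
    then have "\<forall>z\<in>S. - u z $ i - (- \<phi> z) \<le> - u y $ i - (- \<phi> y)" by force
    with 2 show ?case
      using C1[of S \<phi> G] 2(1)[rule_format, of S y "\<lambda>x. - \<phi> x" "\<lambda>x. - G x" i] by auto
  qed
qed

lemma viscosity_subsolution_subset:
  assumes u: "viscosity_subsolution \<Omega>' F u" and "\<Omega> \<subseteq> \<Omega>'"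
  shows "viscosity_subsolution \<Omega> F u"
  unfolding viscosity_subsolution_def
proof (intro allI impI, elim conjE)
  fix i S \<phi> G y
  assume "open S" "S \<subseteq> \<Omega>" "y \<in> S" "C1_on S \<phi> G" "\<forall>z\<in>S. u z $ i - \<phi> z \<le> u y $ i - \<phi> y"
  with \<open>\<Omega> \<subseteq> \<Omega>'\<close> show "F i y (u y) (G y) \<le> 0"
    by (intro u[unfolded viscosity_subsolution_def, rule_format, of S y \<phi> G i]) auto
qed

lemma viscosity_supersolution_subset:
  assumes "viscosity_supersolution \<Omega>' F u" and "\<Omega> \<subseteq> \<Omega>'"
  shows "viscosity_supersolution \<Omega> F u"
  using assms viscosity_subsolution_subset unfolding viscosity_supersolution_uminus by blast

lemma viscosity_subsolution_cong:
  assumes u: "viscosity_subsolution \<Omega> F u" and eq: "\<And>z. z \<in> \<Omega> \<Longrightarrow> w z = u z"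
  shows "viscosity_subsolution \<Omega> F w"
  unfolding viscosity_subsolution_def
proof (intro allI impI, elim conjE)
  fix i S \<phi> G y
  assume *: "open S" "S \<subseteq> \<Omega>" "y \<in> S" "C1_on S \<phi> G" "\<forall>z\<in>S. w z $ i - \<phi> z \<le> w y $ i - \<phi> y"
  have "w z = u z" if "z \<in> S" for z using * eq that by auto
  with * show "F i y (w y) (G y) \<le> 0"
    using u[unfolded viscosity_subsolution_def, rule_format, of S y \<phi> G i] by auto
qed

lemma viscosity_supersolution_cong:
  assumes "viscosity_supersolution \<Omega> F u" and "\<And>z. z \<in> \<Omega> \<Longrightarrow> w z = u z"
  shows "viscosity_supersolution \<Omega> F w"
  using assms viscosity_subsolution_cong[of \<Omega> _ "\<lambda>z. - u z" "\<lambda>z. - w z"]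
  unfolding viscosity_supersolution_uminus by simp

text \<open>Half-relaxed limits are not needed, since for equi-Lipschitz sequences pointwise convergence
  is locally uniform.\<close>

lemma viscosity_subsolution_limit:
  fixes f :: "nat \<Rightarrow> 'a::euclidean_space \<Rightarrow> real^'m"
  assumes F: "\<And>i. continuous_on UNIV (\<lambda>(z, r, q). F i z r q)"
    and lip: "\<And>n. L-lipschitz_on UNIV (f n)"
    and lim: "\<And>z. (\<lambda>n. f n z) \<longlonglongrightarrow> g z"
    and sub: "\<And>n. viscosity_subsolution (\<Omega>' n) F (f n)"
    and dom: "\<And>z. z \<in> \<Omega> \<Longrightarrow> \<exists>r>0. \<forall>\<^sub>F n in sequentially. ball z r \<subseteq> \<Omega>' n"
  shows "viscosity_subsolution \<Omega> F g"
  unfolding viscosity_subsolution_def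
proof (intro allI impI, elim conjE)
  fix i S \<phi> G y
  assume S: "open S" "S \<subseteq> \<Omega>" "y \<in> S" and C1: "C1_on S \<phi> G"
    and mx: "\<forall>z\<in>S. g z $ i - \<phi> z \<le> g y $ i - \<phi> y"
  obtain r1 where r1: "r1 > 0" "\<forall>\<^sub>F n in sequentially. ball y r1 \<subseteq> \<Omega>' n"
    using dom S by blast
  obtain r2 where r2: "r2 > 0" "cball y r2 \<subseteq> S"
    using S by (meson open_contains_cball)
  define r where "r = min r1 r2"
  have r: "r > 0" "cball y r \<subseteq> S" "\<forall>\<^sub>F n in sequentially. ball y r \<subseteq> \<Omega>' n"
    using r1 r2 by (auto simp: r_def elim!: eventually_mono)
  have cf: "continuous_on T (f n)" for n T
    using lip lipschitz_on_continuous_on continuous_on_subset by blast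
  have GD: "\<And>z. z \<in> S \<Longrightarrow> GDERIV \<phi> z :> G z" and cG: "continuous_on S G"
    using C1 by (auto simp: C1_on_def)
  then have c\<phi>: "continuous_on (cball y r) \<phi>"
    using r(2) by (intro continuous_at_imp_continuous_on)
      (auto simp: gderiv_def dest!: has_derivative_continuous)
  \<comment> \<open>The squared distance turns y into a strict maximum for the limit g, which forces
    the maximum points for \<open>f n\<close> to converge to y.\<close>
  have "\<exists>z\<in>cball y r. \<forall>w\<in>cball y r.
      f n w $ i - \<phi> w - (norm (w - y))\<^sup>2 \<le> f n z $ i - \<phi> z - (norm (z - y))\<^sup>2" for n
    using r(1) by (intro continuous_attains_sup continuous_intros cf c\<phi>) auto
  then obtain z where z: "\<And>n. z n \<in> cball y r" and zmax: "\<And>n w. w \<in> cball y r \<Longrightarrow>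
      f n w $ i - \<phi> w - (norm (w - y))\<^sup>2 \<le> f n (z n) $ i - \<phi> (z n) - (norm (z n - y))\<^sup>2"
    by metis
  have unif: "uniform_limit (cball y r) f g sequentially"
    by (rule lipschitz_pointwise_limit_uniform[OF _ lip lim]) simp
  have zy: "z \<longlonglongrightarrow> y"
  proof (rule tendstoI)
    fix e :: real assume "e > 0"
    \<comment> \<open>Half of \<open>e\<^sup>2\<close>, because the closeness of \<open>f n\<close>
      to g is used twice, at y and at \<open>z n\<close>.\<close>
    then have "\<forall>\<^sub>F n in sequentially. \<forall>w\<in>cball y r. dist (f n w) (g w) < e\<^sup>2 / 2"
      by (intro uniform_limitD[OF unif]) auto
    then show "\<forall>\<^sub>F n in sequentially. dist (z n) y < e"
    proof eventually_elim
      case (elim n)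
      have cl: "\<bar>f n w $ i - g w $ i\<bar> < e\<^sup>2 / 2" if "w \<in> cball y r" for w
        using elim that component_le_norm_cart[of "f n w - g w" i] by (force simp: dist_norm)
      have "g (z n) $ i - \<phi> (z n) \<le> g y $ i - \<phi> y"
        using mx z[of n] r(2) by blast
      then have "(norm (z n - y))\<^sup>2 < e\<^sup>2"
        using zmax[of y n] cl[OF z[of n]] cl[of y] r(1) unfolding abs_less_iff by simp
      then show ?case
        using \<open>e > 0\<close> by (simp add: dist_norm power_less_imp_less_base)
    qed
  qed
  have fz: "(\<lambda>n. f n (z n)) \<longlonglongrightarrow> g y"
    using lip lim zy by (rule lipschitz_tendsto_diagonal)
  have "\<forall>\<^sub>F n in sequentially. F i (z n) (f n (z n)) (G (z n) + 2 *\<^sub>R (z n - y)) \<le> 0"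
    using r(3) tendstoD[OF zy r(1)]
  proof eventually_elim
    case (elim n)
    have "C1_on (ball y r) (\<lambda>w. \<phi> w + (norm (w - y))\<^sup>2) (\<lambda>w. G w + 2 *\<^sub>R (w - y))"
      unfolding C1_on_def
    proof
      show "\<forall>w\<in>ball y r. GDERIV (\<lambda>w. \<phi> w + (norm (w - y))\<^sup>2) w :> G w + 2 *\<^sub>R (w - y)"
      proof
        fix w assume "w \<in> ball y r"
        then have "GDERIV \<phi> w :> G w" using GD r(2) by (meson ball_subset_cball subsetD)
        moreover have "GDERIV (\<lambda>w. (norm (w - y))\<^sup>2) w :> 2 *\<^sub>R (w - y)"
          unfolding gderiv_def power2_norm_eq_inner
          by (auto intro!: derivative_eq_intros simp: inner_commute)
        ultimately show "GDERIV (\<lambda>w. \<phi> w + (norm (w - y))\<^sup>2) w :> G w + 2 *\<^sub>R (w - y)"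
          by (rule GDERIV_add)
      qed
      show "continuous_on (ball y r) (\<lambda>w. G w + 2 *\<^sub>R (w - y))"
        using r(2) by (intro continuous_intros continuous_on_subset[OF cG]) auto
    qed
    moreover have "\<forall>w\<in>ball y r. f n w $ i - (\<phi> w + (norm (w - y))\<^sup>2)
        \<le> f n (z n) $ i - (\<phi> (z n) + (norm (z n - y))\<^sup>2)"
      using zmax[of _ n] by (fastforce simp: algebra_simps)
    ultimately show ?case
      using elim
      by (intro sub[of n, unfolded viscosity_subsolution_def, rule_format, of "ball y r" "z n"
          "\<lambda>w. \<phi> w + (norm (w - y))\<^sup>2" "\<lambda>w. G w + 2 *\<^sub>R (w - y)" i])
        (simp add: dist_commute)

  qed
  moreover have "(\<lambda>n. F i (z n) (f n (z n)) (G (z n) + 2 *\<^sub>R (z n - y)))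
      \<longlonglongrightarrow> F i y (g y) (G y + 2 *\<^sub>R (y - y))"
  proof -
    have "isCont G y"
      using cG S by (simp add: continuous_on_eq_continuous_at)
    then have "(\<lambda>n. G (z n)) \<longlonglongrightarrow> G y"
      using zy by (rule isCont_tendsto_compose)
    then have "(\<lambda>n. (z n, f n (z n), G (z n) + 2 *\<^sub>R (z n - y))) \<longlonglongrightarrow> (y, g y, G y + 2 *\<^sub>R (y - y))"
      by (intro tendsto_intros zy fz)
    then show ?thesis
      using continuous_on_tendsto_compose[OF F[of i]] by fastforce
  qed
  ultimately show "F i y (g y) (G y) \<le> 0"
    using tendsto_upperbound[of _ _ sequentially 0] by force
qed

lemma viscosity_supersolution_limit:
  fixes f :: "nat \<Rightarrow> 'a::euclidean_space \<Rightarrow> real^'m"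
  assumes F: "\<And>i. continuous_on UNIV (\<lambda>(z, r, q). F i z r q)"
    and lip: "\<And>n. L-lipschitz_on UNIV (f n)"
    and lim: "\<And>z. (\<lambda>n. f n z) \<longlonglongrightarrow> g z"
    and sup: "\<And>n. viscosity_supersolution (\<Omega>' n) F (f n)"
    and dom: "\<And>z. z \<in> \<Omega> \<Longrightarrow> \<exists>r>0. \<forall>\<^sub>F n in sequentially. ball z r \<subseteq> \<Omega>' n"
  shows "viscosity_supersolution \<Omega> F g"
  unfolding viscosity_supersolution_uminus
proof (rule viscosity_subsolution_limit[where f = "\<lambda>n z. - f n z", OF _ _ _ _ dom])
  show "continuous_on UNIV (\<lambda>(z, r, q). - F i z (- r) (- q))" for i
  proof -
    have "continuous_on UNIV (\<lambda>x. (case (fst x, - fst (snd x), - snd (snd x)) of (z, r, q) \<Rightarrow> F i z r q))"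
      by (rule continuous_on_compose2[OF F[of i]]) (auto intro!: continuous_intros)
    then show ?thesis
      by (simp add: case_prod_beta continuous_on_minus)
  qed
  show "L-lipschitz_on UNIV (\<lambda>z. - f n z)" for n
    using lip[of n] by (simp add: lipschitz_on_def dist_minus)
  show "(\<lambda>n. - f n z) \<longlonglongrightarrow> - g z" for z
    by (intro tendsto_intros lim)
  show "viscosity_subsolution (\<Omega>' n) (\<lambda>i z r q. - F i z (- r) (- q)) (\<lambda>z. - f n z)" for n
    using sup[of n] by (simp add: viscosity_supersolution_uminus)
qed

text \<open>A is the defect being penalized: the difference of two space variables in
  \<open>doubling\<close>, the distance from a frozen point in \<open>subsolution_in_time\<close>.
  Comparing a maximum point with z0 gives \<open>k * (norm A)\<^sup>2 \<le> L * norm A\<close>,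
  hence \<open>k * norm A \<le> L\<close>. So the gradients of the penalty are bounded and converge
  along a subsequence; the second square localizes the maximum points at z0.\<close>

lemma penalized_maxima:
  fixes h :: "'a::euclidean_space \<Rightarrow> real" and A :: "'a \<Rightarrow> 'b::euclidean_space"
  assumes r: "r > 0" and h: "continuous_on (cball z0 r) h"
    and A: "continuous_on (cball z0 r) A" "A z0 = 0"
    and L: "L \<ge> 0" "\<And>z. z \<in> cball z0 r \<Longrightarrow> h z \<le> h z0 + L * norm (A z)"
  obtains z k P where "\<And>n w. w \<in> cball z0 r \<Longrightarrow>
      h w - (k n * (norm (A w))\<^sup>2 + (norm (w - z0))\<^sup>2)
        \<le> h (z n) - (k n * (norm (A (z n)))\<^sup>2 + (norm (z n - z0))\<^sup>2)"
    and "z \<longlonglongrightarrow> z0" and "(\<lambda>n. (2 * k n) *\<^sub>R A (z n)) \<longlonglongrightarrow> P"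
proof -
  let ?\<Psi> = "\<lambda>n w. h w - (real (Suc n) * (norm (A w))\<^sup>2 + (norm (w - z0))\<^sup>2)"
  have "\<exists>z\<in>cball z0 r. \<forall>w\<in>cball z0 r. ?\<Psi> n w \<le> ?\<Psi> n z" for n
    using r by (intro continuous_attains_sup continuous_intros h A) auto
  then obtain z where z: "\<And>n. z n \<in> cball z0 r"
    and zmax: "\<And>n w. w \<in> cball z0 r \<Longrightarrow> ?\<Psi> n w \<le> ?\<Psi> n (z n)"
    by metis
  have *: "real (Suc n) * (norm (A (z n)))\<^sup>2 + (norm (z n - z0))\<^sup>2 \<le> L * norm (A (z n))" for n
    using zmax[of z0 n] L(2)[OF z[of n]] r A(2) by simp
  have A_le: "real (Suc n) * norm (A (z n)) \<le> L" for n
  proof (cases "A (z n) = 0")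
    case False
    have "(real (Suc n) * norm (A (z n))) * norm (A (z n)) \<le> L * norm (A (z n))"
      using *[of n] by (simp add: power2_eq_square mult.assoc add_le_imp_le_left add_increasing2
          order_trans[OF _ *[of n]])
    then show ?thesis using False by (simp add: mult_le_cancel_right)
  qed (use L in simp)
  have dist_le: "(norm (z n - z0))\<^sup>2 \<le> L\<^sup>2 / real (Suc n)" for n
  proof -
    have "norm (A (z n)) \<le> L / real (Suc n)"
      using A_le[of n] by (simp add: pos_le_divide_eq mult.commute)
    then have "L * norm (A (z n)) \<le> L * (L / real (Suc n))"
      using L(1) by (intro mult_left_mono)
    moreover have "0 \<le> real (Suc n) * (norm (A (z n)))\<^sup>2" by simp
    moreover have "L * (L / real (Suc n)) = L\<^sup>2 / real (Suc n)"
      by (simp add: power2_eq_square)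
    ultimately show ?thesis
      using *[of n] by linarith
  qed
  have "(\<lambda>n. (norm (z n - z0))\<^sup>2) \<longlonglongrightarrow> 0"
  proof (rule tendsto_sandwich[OF _ _ tendsto_const])
    show "(\<lambda>n. L\<^sup>2 / real (Suc n)) \<longlonglongrightarrow> 0"
      by (rule LIMSEQ_Suc[OF lim_const_over_n])
  qed (use dist_le in auto)
  then have "z \<longlonglongrightarrow> z0"
    using tendsto_real_sqrt by (fastforce simp: tendsto_norm_zero_iff LIM_zero_iff)
  let ?P = "\<lambda>n. (2 * real (Suc n)) *\<^sub>R A (z n)"
  have "\<forall>n. ?P n \<in> cball 0 (2 * L)"
  proof
    fix n
    have "norm (?P n) = 2 * (real (Suc n) * norm (A (z n)))"
      by simp
    with A_le[of n] show "?P n \<in> cball 0 (2 * L)"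
      by (simp del: of_nat_Suc)
  qed
  then obtain P \<sigma> where "P \<in> cball 0 (2 * L)" and \<sigma>: "strict_mono (\<sigma> :: nat \<Rightarrow> nat)" "(?P \<circ> \<sigma>) \<longlonglongrightarrow> P"
    by (rule seq_compactE[OF compact_imp_seq_compact[OF compact_cball]])
  show ?thesis
  proof (rule that)
    show "(z \<circ> \<sigma>) \<longlonglongrightarrow> z0"
      using \<open>z \<longlonglongrightarrow> z0\<close> \<sigma>(1) by (rule LIMSEQ_subseq_LIMSEQ)
    show "(\<lambda>n. (2 * real (Suc (\<sigma> n))) *\<^sub>R A ((z \<circ> \<sigma>) n)) \<longlonglongrightarrow> P"
      using \<sigma>(2) by (simp add: o_def)
  qed (use zmax in auto)
qed

subsection \<open>Doubling of variables\<close>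

abbreviation evolution_op ::
  "('m \<Rightarrow> real^'n \<Rightarrow> real^'n \<Rightarrow> real) \<Rightarrow> real^'m^'m \<Rightarrow>
   'm \<Rightarrow> (real^'n) \<times> real \<Rightarrow> real^'m \<Rightarrow> (real^'n) \<times> real \<Rightarrow> real" where
  "evolution_op H D \<equiv> (\<lambda>i (x, t) r (p, a). a + H i x p + (\<Sum>j\<in>UNIV. D $ i $ j * r $ j))"

lemma evolution_op_eq:
  "evolution_op H D i z r q = snd q + H i (fst z) (fst q) + (D *v r) $ i"
  by (simp add: case_prod_beta matrix_vector_mult_def)

lemma continuous_on_evolution_op:
  assumes "\<And>i. continuous_on UNIV (\<lambda>(x, p). H i x p)"
  shows "continuous_on UNIV (\<lambda>(z, r, q). evolution_op H D i z r q)"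
proof -
  have "continuous_on UNIV (\<lambda>w. case (fst (fst w), fst (snd (snd w))) of (x, p) \<Rightarrow> H i x p)"
    by (rule continuous_on_compose2[OF assms]) (auto intro!: continuous_intros)
  then show ?thesis
    by (auto simp: case_prod_beta intro!: continuous_intros)
qed

lemma tendsto_hamiltonian:
  assumes "continuous_on UNIV (\<lambda>(x, p). F x p)" "(X \<longlongrightarrow> x) sequentially" "(P \<longlongrightarrow> p) sequentially"
  shows "((\<lambda>n. F (X n) (P n)) \<longlongrightarrow> F x p) sequentially"
  using continuous_on_tendsto_compose[OF assms(1) tendsto_Pair[OF assms(2,3)]] by simp

text \<open>The factor c is positive for subsolutions and negative for supersolutions.\<close>

definition penalty :: "real \<Rightarrow> real \<Rightarrow> 'a \<Rightarrow> 'a \<times> real \<Rightarrow> real \<Rightarrow> ('a::real_inner) \<times> real \<Rightarrow> real" where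
  "penalty c k y \<alpha>0 a \<alpha> = c * (k * (norm (fst \<alpha> - y))\<^sup>2 + (norm (\<alpha> - \<alpha>0))\<^sup>2 + a * snd \<alpha>)"

definition penalty_grad :: "real \<Rightarrow> real \<Rightarrow> 'a \<Rightarrow> 'a \<times> real \<Rightarrow> real \<Rightarrow> ('a::real_inner) \<times> real \<Rightarrow> 'a \<times> real" where
  "penalty_grad c k y \<alpha>0 a \<alpha> =
    c *\<^sub>R ((2 * k) *\<^sub>R (fst \<alpha> - y) + 2 *\<^sub>R (fst \<alpha> - fst \<alpha>0), 2 * (snd \<alpha> - snd \<alpha>0) + a)"

lemma C1_on_penalty: "C1_on S (penalty c k y \<alpha>0 a) (penalty_grad c k y \<alpha>0 a)"
proof -
  have "GDERIV (penalty c k y \<alpha>0 a) \<alpha> :> penalty_grad c k y \<alpha>0 a \<alpha>" for \<alpha>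
    unfolding gderiv_def penalty_def penalty_grad_def power2_norm_eq_inner
  proof (rule has_derivative_eq_rhs, (rule derivative_intros)+, rule ext)
    fix h :: "'a \<times> real"
    have *: "(fst \<alpha> - y) \<bullet> fst h = fst h \<bullet> (fst \<alpha> - y)" "(\<alpha> - \<alpha>0) \<bullet> h = h \<bullet> (\<alpha> - \<alpha>0)"
      by (rule inner_commute)+
    show "c * (k * ((fst \<alpha> - y) \<bullet> (fst h - 0) + (fst h - 0) \<bullet> (fst \<alpha> - y)) +
        ((\<alpha> - \<alpha>0) \<bullet> (h - 0) + (h - 0) \<bullet> (\<alpha> - \<alpha>0)) + a * snd h) =
      h \<bullet> c *\<^sub>R ((2 * k) *\<^sub>R (fst \<alpha> - y) + 2 *\<^sub>R (fst \<alpha> - fst \<alpha>0), 2 * (snd \<alpha> - snd \<alpha>0) + a)"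
      unfolding diff_0_right * by (simp add: inner_prod_def inner_add_right algebra_simps)
  qed
  then show ?thesis
    unfolding C1_on_def penalty_grad_def by (auto intro!: continuous_intros)
qed

lemma viscosity_subsolution_penalty:
  fixes f :: "(real^'n) \<times> real \<Rightarrow> real^'m"
  assumes "viscosity_subsolution \<Omega> (evolution_op H D) f"
    and "ball \<alpha>0 r \<subseteq> \<Omega>" "\<alpha> \<in> ball \<alpha>0 r"
    and "\<And>\<beta>. \<beta> \<in> ball \<alpha>0 r \<Longrightarrow> f \<beta> $ i - penalty c k y \<alpha>0 a \<beta> \<le> f \<alpha> $ i - penalty c k y \<alpha>0 a \<alpha>"
  shows "c * (2 * (snd \<alpha> - snd \<alpha>0) + a)
      + H i (fst \<alpha>) (c *\<^sub>R ((2 * k) *\<^sub>R (fst \<alpha> - y) + 2 *\<^sub>R (fst \<alpha> - fst \<alpha>0))) + (D *v f \<alpha>) $ i \<le> 0"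
proof -
  have "evolution_op H D i \<alpha> (f \<alpha>) (penalty_grad c k y \<alpha>0 a \<alpha>) \<le> 0"
    using assms(2-)
    by (intro assms(1)[unfolded viscosity_subsolution_def, rule_format, of "ball \<alpha>0 r" _ "penalty c k y \<alpha>0 a"])
       (use C1_on_penalty in blast)
  then show ?thesis
    unfolding evolution_op_eq by (simp add: penalty_grad_def)
qed

lemma viscosity_supersolution_penalty:
  fixes f :: "(real^'n) \<times> real \<Rightarrow> real^'m"
  assumes "viscosity_supersolution \<Omega> (evolution_op H D) f"
    and "ball \<alpha>0 r \<subseteq> \<Omega>" "\<alpha> \<in> ball \<alpha>0 r"
    and "\<And>\<beta>. \<beta> \<in> ball \<alpha>0 r \<Longrightarrow> f \<alpha> $ i - penalty c k y \<alpha>0 a \<alpha> \<le> f \<beta> $ i - penalty c k y \<alpha>0 a \<beta>"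
  shows "0 \<le> c * (2 * (snd \<alpha> - snd \<alpha>0) + a)
      + H i (fst \<alpha>) (c *\<^sub>R ((2 * k) *\<^sub>R (fst \<alpha> - y) + 2 *\<^sub>R (fst \<alpha> - fst \<alpha>0))) + (D *v f \<alpha>) $ i"
proof -
  have "0 \<le> evolution_op H D i \<alpha> (f \<alpha>) (penalty_grad c k y \<alpha>0 a \<alpha>)"
    using assms(2-)
    by (intro assms(1)[unfolded viscosity_supersolution_def, rule_format, of "ball \<alpha>0 r" _ "penalty c k y \<alpha>0 a"])
       (use C1_on_penalty in blast)
  then show ?thesis
    unfolding evolution_op_eq by (simp add: penalty_grad_def)
qed

lemma lipschitz_on_component:
  fixes f :: "'a::metric_space \<Rightarrow> real^'m"
  assumes "L-lipschitz_on UNIV f"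
  shows "\<bar>f x $ i - f y $ i\<bar> \<le> L * dist x y"
  using component_le_norm_cart[of "f x - f y" i] lipschitz_onD[OF assms, of x y]
  by (simp add: dist_norm)

text \<open>Doubling of the space variable only. The two times stay independent, so that this applies
  both to comparison and to values of one solution at two different times.\<close>

lemma doubling:
  fixes f g :: "(real^'n) \<times> real \<Rightarrow> real^'m"
  assumes H: "\<And>i. continuous_on UNIV (\<lambda>(x, p). H i x p)"
    and f: "viscosity_subsolution \<Omega> (evolution_op H D) f" "continuous_on UNIV f"
    and g: "viscosity_supersolution \<Omega>' (evolution_op H D) g" "L-lipschitz_on UNIV g"
    and r: "r > 0" "ball (x0, t0) r \<subseteq> \<Omega>" "ball (x0, s0) r \<subseteq> \<Omega>'"
    and \<mu>: "\<mu> > 0"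
    and mx: "\<And>x t s. \<bar>t - t0\<bar> \<le> r \<Longrightarrow> \<bar>s - s0\<bar> \<le> r \<Longrightarrow>
      \<mu> * f (x, t) $ i - g (x, s) $ i - a * t - b * s
        \<le> \<mu> * f (x0, t0) $ i - g (x0, s0) $ i - a * t0 - b * s0"
  obtains P where "a / \<mu> + H i x0 ((1 / \<mu>) *\<^sub>R P) + (D *v f (x0, t0)) $ i \<le> 0"
    and "0 \<le> - b + H i x0 P + (D *v g (x0, s0)) $ i"
proof -
  define \<alpha>0 where "\<alpha>0 = (x0, t0)"
  define \<beta>0 where "\<beta>0 = (x0, s0)"
  let ?h = "\<lambda>z. \<mu> * f (fst z) $ i - g (snd z) $ i - a * snd (fst z) - b * snd (snd z)"
  let ?A = "\<lambda>z :: ((real^'n) \<times> real) \<times> ((real^'n) \<times> real). fst (fst z) - fst (snd z)"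
  have cg: "continuous_on UNIV g"
    using g(2) by (rule lipschitz_on_continuous_on)
  have "L \<ge> 0" using g(2) by (rule lipschitz_on_nonneg)
  have h_le: "?h z \<le> ?h (\<alpha>0, \<beta>0) + L * norm (?A z)" if "z \<in> cball (\<alpha>0, \<beta>0) r" for z
  proof -
    obtain x t y s where z: "z = ((x, t), (y, s))" by (metis surj_pair)
    have "\<bar>t - t0\<bar> \<le> dist z (\<alpha>0, \<beta>0)" "\<bar>s - s0\<bar> \<le> dist z (\<alpha>0, \<beta>0)"
      using dist_snd_le[of "(x, t)" \<alpha>0] dist_fst_le[of z "(\<alpha>0, \<beta>0)"]
        dist_snd_le[of "(y, s)" \<beta>0] dist_snd_le[of z "(\<alpha>0, \<beta>0)"]
      by (auto simp: z \<alpha>0_def \<beta>0_def dist_real_def)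
    moreover have "dist z (\<alpha>0, \<beta>0) \<le> r" using that by (simp add: dist_commute)
    ultimately have "\<bar>t - t0\<bar> \<le> r" "\<bar>s - s0\<bar> \<le> r" by linarith+
    \<comment> \<open>The maximum hypothesis covers only equal space variables. Moving y to x costs
      at most L times the penalized quantity.\<close>
    from mx[OF this, of x] have "?h ((x, t), (x, s)) \<le> ?h (\<alpha>0, \<beta>0)"
      by (simp add: \<alpha>0_def \<beta>0_def)
    moreover have "\<bar>g (x, s) $ i - g (y, s) $ i\<bar> \<le> L * norm (x - y)"
      using lipschitz_on_component[OF g(2), of "(x, s)" i "(y, s)"]
      by (simp add: dist_Pair_Pair dist_norm)
    ultimately show ?thesis by (simp add: z)
  qed
  obtain z k P where zmax: "\<And>n w. w \<in> cball (\<alpha>0, \<beta>0) r \<Longrightarrow>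
      ?h w - (k n * (norm (?A w))\<^sup>2 + (norm (w - (\<alpha>0, \<beta>0)))\<^sup>2)
        \<le> ?h (z n) - (k n * (norm (?A (z n)))\<^sup>2 + (norm (z n - (\<alpha>0, \<beta>0)))\<^sup>2)"
    and z: "z \<longlonglongrightarrow> (\<alpha>0, \<beta>0)" and P: "(\<lambda>n. (2 * k n) *\<^sub>R ?A (z n)) \<longlonglongrightarrow> P"
  proof (rule penalized_maxima[of r "(\<alpha>0, \<beta>0)" ?h ?A L])
    show "continuous_on (cball (\<alpha>0, \<beta>0) r) ?h"
      by (intro continuous_intros continuous_on_compose2[OF f(2)] continuous_on_compose2[OF cg]) auto
    show "continuous_on (cball (\<alpha>0, \<beta>0) r) ?A"
      by (intro continuous_intros)
  qed (use \<open>L \<ge> 0\<close> r h_le in \<open>auto simp: \<alpha>0_def \<beta>0_def\<close>)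
  define \<alpha> where "\<alpha> n = fst (z n)" for n
  define \<beta> where "\<beta> n = snd (z n)" for n
  have \<alpha>: "\<alpha> \<longlonglongrightarrow> \<alpha>0" and \<beta>: "\<beta> \<longlonglongrightarrow> \<beta>0"
    using tendsto_fst[OF z] tendsto_snd[OF z] by (auto simp: \<alpha>_def[abs_def] \<beta>_def[abs_def])
  have P': "(\<lambda>n. (2 * k n) *\<^sub>R (fst (\<alpha> n) - fst (\<beta> n))) \<longlonglongrightarrow> P"
    using P by (simp add: \<alpha>_def \<beta>_def)
  have split: "(norm ((v, w) - (\<alpha>0, \<beta>0)))\<^sup>2 = (norm (v - \<alpha>0))\<^sup>2 + (norm (w - \<beta>0))\<^sup>2" for v w
    by (simp add: norm_Pair)
  have max2: "?h (v, w) - (k n * (norm (fst v - fst w))\<^sup>2 + ((norm (v - \<alpha>0))\<^sup>2 + (norm (w - \<beta>0))\<^sup>2))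
      \<le> ?h (\<alpha> n, \<beta> n) - (k n * (norm (fst (\<alpha> n) - fst (\<beta> n)))\<^sup>2
          + ((norm (\<alpha> n - \<alpha>0))\<^sup>2 + (norm (\<beta> n - \<beta>0))\<^sup>2))"
    if "v \<in> ball \<alpha>0 (r / 2)" "w \<in> ball \<beta>0 (r / 2)" for v w n
  proof -
    \<comment> \<open>Halving the radius puts the product of the two balls inside the ball on which
      the maximum was taken, so each variable can be tested with the other one fixed.\<close>
    have "dist (\<alpha>0, \<beta>0) (v, w) \<le> dist \<alpha>0 v + dist \<beta>0 w"
      unfolding dist_Pair_Pair by (rule sqrt_sum_squares_le_sum) auto
    then have "(v, w) \<in> cball (\<alpha>0, \<beta>0) r" using that by simp
    from zmax[OF this, of n] show ?thesis
      using split[of v w] split[of "\<alpha> n" "\<beta> n"] by (simp add: \<alpha>_def \<beta>_def)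
  qed
  have near: "\<forall>\<^sub>F n in sequentially. \<alpha> n \<in> ball \<alpha>0 (r / 2) \<and> \<beta> n \<in> ball \<beta>0 (r / 2)"
    using tendstoD[OF \<alpha>, of "r / 2"] tendstoD[OF \<beta>, of "r / 2"] r(1)
    by (simp add: dist_commute eventually_conj)
  let ?T = "\<lambda>n. (1 / \<mu>) * (2 * (snd (\<alpha> n) - snd \<alpha>0) + a)
      + H i (fst (\<alpha> n)) ((1 / \<mu>) *\<^sub>R ((2 * k n) *\<^sub>R (fst (\<alpha> n) - fst (\<beta> n)) + 2 *\<^sub>R (fst (\<alpha> n) - fst \<alpha>0)))
      + (D *v f (\<alpha> n)) $ i"
  have "\<forall>\<^sub>F n in sequentially. ?T n \<le> 0"
    using near
  proof eventually_elim
    case (elim n)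
    show ?case
    proof (rule viscosity_subsolution_penalty[OF f(1), of _ "r / 2"])
      show "ball \<alpha>0 (r / 2) \<subseteq> \<Omega>" using r subset_ball[of "r / 2" r] by (auto simp: \<alpha>0_def)
      show "\<alpha> n \<in> ball \<alpha>0 (r / 2)" using elim by simp
      fix v assume "v \<in> ball \<alpha>0 (r / 2)"
      from max2[OF this, of "\<beta> n" n] elim
      have "(1 / \<mu>) * (\<mu> * f v $ i - (k n * (norm (fst v - fst (\<beta> n)))\<^sup>2 + (norm (v - \<alpha>0))\<^sup>2 + a * snd v))
          \<le> (1 / \<mu>) * (\<mu> * f (\<alpha> n) $ i - (k n * (norm (fst (\<alpha> n) - fst (\<beta> n)))\<^sup>2
              + (norm (\<alpha> n - \<alpha>0))\<^sup>2 + a * snd (\<alpha> n)))"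
        using \<mu> by (intro mult_left_mono) auto
      then show "f v $ i - penalty (1 / \<mu>) (k n) (fst (\<beta> n)) \<alpha>0 a v
          \<le> f (\<alpha> n) $ i - penalty (1 / \<mu>) (k n) (fst (\<beta> n)) \<alpha>0 a (\<alpha> n)"
        using \<mu> by (simp add: penalty_def right_diff_distrib)
    qed
  qed
  \<comment> \<open>Both test gradients come from the one convergent sequence
    \<open>(2 * k n) *\<^sub>R (x - y)\<close>: the subsolution sees P divided by \<mu>, the
    supersolution sees P. The localizing terms vanish in the limit.\<close>
  moreover have "?T \<longlonglongrightarrow> (1 / \<mu>) * (2 * (snd \<alpha>0 - snd \<alpha>0) + a)
      + H i (fst \<alpha>0) ((1 / \<mu>) *\<^sub>R (P + 2 *\<^sub>R (fst \<alpha>0 - fst \<alpha>0))) + (D *v f \<alpha>0) $ i"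
    by (intro tendsto_intros tendsto_hamiltonian[OF H] \<alpha> P' tendsto_vec_nth
        bounded_linear.tendsto[OF matrix_vector_mul_bounded_linear]
        continuous_on_tendsto_compose[OF f(2)]) auto
  ultimately have "(1 / \<mu>) * (2 * (snd \<alpha>0 - snd \<alpha>0) + a)
      + H i (fst \<alpha>0) ((1 / \<mu>) *\<^sub>R (P + 2 *\<^sub>R (fst \<alpha>0 - fst \<alpha>0))) + (D *v f \<alpha>0) $ i \<le> 0"
    by (intro tendsto_upperbound) auto
  then have 1: "a / \<mu> + H i x0 ((1 / \<mu>) *\<^sub>R P) + (D *v f (x0, t0)) $ i \<le> 0"
    by (simp add: \<alpha>0_def)
  let ?U = "\<lambda>n. (- 1) * (2 * (snd (\<beta> n) - snd \<beta>0) + b)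
      + H i (fst (\<beta> n)) ((- 1) *\<^sub>R ((2 * k n) *\<^sub>R (fst (\<beta> n) - fst (\<alpha> n)) + 2 *\<^sub>R (fst (\<beta> n) - fst \<beta>0)))
      + (D *v g (\<beta> n)) $ i"
  have "\<forall>\<^sub>F n in sequentially. 0 \<le> ?U n"
    using near
  proof eventually_elim
    case (elim n)
    show ?case
    proof (rule viscosity_supersolution_penalty[OF g(1), of _ "r / 2"])
      show "ball \<beta>0 (r / 2) \<subseteq> \<Omega>'" using r subset_ball[of "r / 2" r] by (auto simp: \<beta>0_def)
      show "\<beta> n \<in> ball \<beta>0 (r / 2)" using elim by simp
      fix w assume "w \<in> ball \<beta>0 (r / 2)"
      from max2[OF _ this, of "\<alpha> n" n] elim
      show "g (\<beta> n) $ i - penalty (- 1) (k n) (fst (\<alpha> n)) \<beta>0 b (\<beta> n)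
          \<le> g w $ i - penalty (- 1) (k n) (fst (\<alpha> n)) \<beta>0 b w"
        by (simp add: penalty_def norm_minus_commute)
    qed
  qed
  moreover have "?U \<longlonglongrightarrow> (- 1) * (2 * (snd \<beta>0 - snd \<beta>0) + b)
      + H i (fst \<beta>0) ((- 1) *\<^sub>R (- P + 2 *\<^sub>R (fst \<beta>0 - fst \<beta>0))) + (D *v g \<beta>0) $ i"
  proof -
    have "(\<lambda>n. (2 * k n) *\<^sub>R (fst (\<beta> n) - fst (\<alpha> n))) \<longlonglongrightarrow> - P"
      using tendsto_minus[OF P'] by (simp add: scaleR_minus_right[symmetric] del: scaleR_minus_right)
    then show ?thesis
      by (intro tendsto_intros tendsto_hamiltonian[OF H] \<beta> tendsto_vec_nth
          bounded_linear.tendsto[OF matrix_vector_mul_bounded_linear]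
          continuous_on_tendsto_compose[OF cg]) auto
  qed
  ultimately have "0 \<le> (- 1) * (2 * (snd \<beta>0 - snd \<beta>0) + b)
      + H i (fst \<beta>0) ((- 1) *\<^sub>R (- P + 2 *\<^sub>R (fst \<beta>0 - fst \<beta>0))) + (D *v g \<beta>0) $ i"
    by (intro tendsto_lowerbound) auto
  then have 2: "0 \<le> - b + H i x0 P + (D *v g (x0, s0)) $ i"
    by (simp add: \<beta>0_def)
  show ?thesis using that 1 2 .
qed

text \<open>Where the Hamiltonian is nonnegative, a subsolution satisfies an ordinary differential
  inequality in time, although no information on the Hamiltonian at nearby points is given.\<close>

lemma subsolution_in_time:
  fixes f :: "(real^'n) \<times> real \<Rightarrow> real^'m"
  assumes H: "\<And>i. continuous_on UNIV (\<lambda>(x, p). H i x p)"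
    and f: "viscosity_subsolution \<Omega> (evolution_op H D) f" "L-lipschitz_on UNIV f"
    and r: "r > 0" "ball (x0, t0) r \<subseteq> \<Omega>"
    and nonneg: "\<And>p. 0 \<le> H i x0 p"
    and mx: "\<And>t. \<bar>t - t0\<bar> \<le> r \<Longrightarrow> f (x0, t) $ i - a * t \<le> f (x0, t0) $ i - a * t0"
  shows "a + (D *v f (x0, t0)) $ i \<le> 0"
proof -
  define \<alpha>0 where "\<alpha>0 = (x0, t0)"
  let ?h = "\<lambda>z. f z $ i - a * snd z"
  let ?A = "\<lambda>z :: (real^'n) \<times> real. fst z - x0"
  have cf: "continuous_on UNIV f"
    using f(2) by (rule lipschitz_on_continuous_on)
  have "L \<ge> 0" using f(2) by (rule lipschitz_on_nonneg)
  have h_le: "?h z \<le> ?h \<alpha>0 + L * norm (?A z)" if "z \<in> cball \<alpha>0 r" for z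
  proof -
    obtain x t where z: "z = (x, t)" by (metis surj_pair)
    have "\<bar>t - t0\<bar> \<le> r"
      using dist_snd_le[of z \<alpha>0] that by (simp add: z \<alpha>0_def dist_real_def dist_commute)
    from mx[OF this] have "?h (x0, t) \<le> ?h \<alpha>0"
      by (simp add: \<alpha>0_def)
    moreover have "\<bar>f (x, t) $ i - f (x0, t) $ i\<bar> \<le> L * norm (x - x0)"
      using lipschitz_on_component[OF f(2), of "(x, t)" i "(x0, t)"]
      by (simp add: dist_Pair_Pair dist_norm)
    ultimately show ?thesis by (simp add: z)
  qed
  obtain z k P where zmax: "\<And>n w. w \<in> cball \<alpha>0 r \<Longrightarrow>
      ?h w - (k n * (norm (?A w))\<^sup>2 + (norm (w - \<alpha>0))\<^sup>2)
        \<le> ?h (z n) - (k n * (norm (?A (z n)))\<^sup>2 + (norm (z n - \<alpha>0))\<^sup>2)"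
    and z: "z \<longlonglongrightarrow> \<alpha>0" and P: "(\<lambda>n. (2 * k n) *\<^sub>R ?A (z n)) \<longlonglongrightarrow> P"
  proof (rule penalized_maxima[of r \<alpha>0 ?h ?A L])
    show "continuous_on (cball \<alpha>0 r) ?h"
      by (intro continuous_intros continuous_on_compose2[OF cf]) auto
    show "continuous_on (cball \<alpha>0 r) ?A"
      by (intro continuous_intros)
  qed (use \<open>L \<ge> 0\<close> r h_le in \<open>auto simp: \<alpha>0_def\<close>)
  let ?T = "\<lambda>n. 1 * (2 * (snd (z n) - snd \<alpha>0) + a)
      + H i (fst (z n)) (1 *\<^sub>R ((2 * k n) *\<^sub>R (fst (z n) - x0) + 2 *\<^sub>R (fst (z n) - fst \<alpha>0)))
      + (D *v f (z n)) $ i"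
  have "\<forall>\<^sub>F n in sequentially. ?T n \<le> 0"
    using tendstoD[OF z r(1)]
  proof eventually_elim
    case (elim n)
    show ?case
    proof (rule viscosity_subsolution_penalty[OF f(1), of _ r])
      show "ball \<alpha>0 r \<subseteq> \<Omega>" "z n \<in> ball \<alpha>0 r" using r(2) elim by (auto simp: \<alpha>0_def dist_commute)
      fix v assume "v \<in> ball \<alpha>0 r"
      then show "f v $ i - penalty 1 (k n) x0 \<alpha>0 a v \<le> f (z n) $ i - penalty 1 (k n) x0 \<alpha>0 a (z n)"
        using zmax[of v n] by (simp add: penalty_def)
    qed
  qed
  moreover have "?T \<longlonglongrightarrow> 1 * (2 * (snd \<alpha>0 - snd \<alpha>0) + a)
      + H i (fst \<alpha>0) (1 *\<^sub>R (P + 2 *\<^sub>R (fst \<alpha>0 - fst \<alpha>0))) + (D *v f \<alpha>0) $ i"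
    by (intro tendsto_intros tendsto_hamiltonian[OF H] z P tendsto_vec_nth
        bounded_linear.tendsto[OF matrix_vector_mul_bounded_linear]
        continuous_on_tendsto_compose[OF cf]) auto
  ultimately have "1 * (2 * (snd \<alpha>0 - snd \<alpha>0) + a)
      + H i (fst \<alpha>0) (1 *\<^sub>R (P + 2 *\<^sub>R (fst \<alpha>0 - fst \<alpha>0))) + (D *v f \<alpha>0) $ i \<le> 0"
    by (intro tendsto_upperbound) auto
  then show ?thesis
    using nonneg[of P] by (simp add: \<alpha>0_def)
qed

subsection \<open>Monotone irreducible coupling\<close>

text \<open>Since the row sums to zero, its value on r is the sum of the terms
  \<open>D $ i $ j * (r $ j - r $ i)\<close>. For a maximal component i none of them is negative, so
  a nonpositive sum makes each of them vanish.\<close>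

lemma monotone_matrix_row_nonneg:
  assumes D: "monotone_matrix D" and r: "\<And>j. r $ j \<le> r $ i"
  shows "0 \<le> (D *v r) $ i"
    and "(D *v r) $ i \<le> 0 \<Longrightarrow> D $ i $ j \<noteq> 0 \<Longrightarrow> r $ j = r $ i"
proof -
  have "(\<Sum>j\<in>UNIV. D $ i $ j) = 0"
    using D by (simp add: monotone_matrix_def)
  then have "(\<Sum>j\<in>UNIV. D $ i $ j * r $ i) = 0"
    by (simp add: sum_distrib_right[symmetric])
  then have eq: "(D *v r) $ i = (\<Sum>j\<in>UNIV. D $ i $ j * (r $ j - r $ i))"
    by (simp add: matrix_vector_mult_def right_diff_distrib sum_subtractf)
  have nn: "0 \<le> D $ i $ j * (r $ j - r $ i)" for j
    using D r[of j] by (cases "i = j") (auto simp: monotone_matrix_def mult_nonpos_nonpos)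
  show "0 \<le> (D *v r) $ i"
    unfolding eq by (rule sum_nonneg) (use nn in auto)
  assume "(D *v r) $ i \<le> 0" "D $ i $ j \<noteq> 0"
  moreover from this(1) have "(\<Sum>j\<in>UNIV. D $ i $ j * (r $ j - r $ i)) = 0"
    using nn by (intro antisym sum_nonneg) (auto simp: eq)
  then have "D $ i $ j * (r $ j - r $ i) = 0"
    using nn by (subst (asm) sum_nonneg_eq_0_iff) auto
  ultimately show "r $ j = r $ i" by simp
qed

text \<open>No nonzero entry of D leads out of the set of indices at which the maximum is attained,
  and irreducibility leaves no proper nonempty set with this property.\<close>

lemma irreducible_matrix_max_principle:
  assumes D: "monotone_matrix D" "irreducible_matrix D"
    and le: "\<And>j. r $ j \<le> M" and "r $ i0 = M"
    and sub: "\<And>i. r $ i = M \<Longrightarrow> (D *v r) $ i \<le> 0"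
  shows "r $ j = M"
proof (rule ccontr)
  assume "r $ j \<noteq> M"
  then have "{i. r $ i = M} \<noteq> {} \<and> {i. r $ i = M} \<noteq> UNIV"
    using \<open>r $ i0 = M\<close> by auto
  then obtain i j where "r $ i = M" "r $ j \<noteq> M" "D $ i $ j \<noteq> 0"
    using D(2)[unfolded irreducible_matrix_def, rule_format, of "{i. r $ i = M}"] by auto
  then show False
    using monotone_matrix_row_nonneg(2)[OF D(1), of r i j] le sub by auto
qed

subsection \<open>Comparison and compactness\<close>

text \<open>The translation k depends on x alone. One k thus serves several periodic functions
  simultaneously, such as the values of one solution at two times.\<close>

lemma periodic_cube:
  fixes x :: "real^'n"
  obtains k where "\<And>f :: real^'n \<Rightarrow> 'b. periodic f \<Longrightarrow> f (x + k) = f x" and "x + k \<in> cbox 0 1"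
proof
  let ?k = "\<chi> l. - of_int \<lfloor>x $ l\<rfloor>"
  show "f (x + ?k) = f x" if "periodic f" for f :: "real^'n \<Rightarrow> 'b"
    using that by (simp add: periodic_def)
  show "x + ?k \<in> cbox 0 1"
    unfolding mem_box_cart by (auto simp: algebra_simps) linarith+
qed

lemma periodic_attains_max:
  fixes \<phi> :: "'m::finite \<Rightarrow> (real^'n) \<times> real \<Rightarrow> real"
  assumes T: "compact T" "T \<noteq> {}" and cont: "\<And>i. continuous_on UNIV (\<phi> i)"
    and per: "\<And>i t. periodic (\<lambda>x. \<phi> i (x, t))"
  obtains i x t where "t \<in> T" "\<And>j y s. s \<in> T \<Longrightarrow> \<phi> j (y, s) \<le> \<phi> i (x, t)"
proof -
  let ?C = "cbox 0 (1 :: real^'n) \<times> T"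
  have ne: "?C \<noteq> {}" using T(2) by (auto simp: mem_box_cart ex_in_conv[symmetric] intro!: exI[of _ 0])
  have "\<exists>z\<in>?C. \<forall>w\<in>?C. \<phi> i w \<le> \<phi> i z" for i
    using T(1) ne
    by (intro continuous_attains_sup compact_Times compact_cbox continuous_on_subset[OF cont]) auto
  then obtain z where z: "\<And>i. z i \<in> ?C" "\<And>i w. w \<in> ?C \<Longrightarrow> \<phi> i w \<le> \<phi> i (z i)"
    by metis
  obtain i where i: "\<And>j. \<phi> j (z j) \<le> \<phi> i (z i)"
  proof -
    have "Max (range (\<lambda>j. \<phi> j (z j))) \<in> range (\<lambda>j. \<phi> j (z j))" by (rule Max_in) auto
    then obtain i where "Max (range (\<lambda>j. \<phi> j (z j))) = \<phi> i (z i)" by (rule rangeE)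
    then show ?thesis using that[of i] by (metis Max_ge finite finite_imageI rangeI)
  qed
  show ?thesis
  proof
    show "snd (z i) \<in> T" using z(1)[of i] by (auto simp: mem_Times_iff)
    fix j y s assume "s \<in> T"
    obtain k where k: "\<And>f :: real^'n \<Rightarrow> real. periodic f \<Longrightarrow> f (y + k) = f y" "y + k \<in> cbox 0 1"
      using periodic_cube by blast
    have "\<phi> j (y, s) = \<phi> j (y + k, s)" using k(1)[OF per] by simp
    also have "\<dots> \<le> \<phi> j (z j)" using k(2) \<open>s \<in> T\<close> by (intro z(2)) auto
    also have "\<dots> \<le> \<phi> i (z i)" by (rule i)
    finally show "\<phi> j (y, s) \<le> \<phi> i (fst (z i), snd (z i))" by simp
  qed
qed

text \<open>A small linear penalty in time turns growth beyond the initial bound into a maximum at an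
  interior time of an infinite time interval, so no terminal time has to be treated.\<close>

lemma infinite_horizon_max:
  fixes \<phi> :: "'m::finite \<Rightarrow> (real^'n) \<times> real \<Rightarrow> real"
  assumes cont: "\<And>i. continuous_on UNIV (\<phi> i)" and per: "\<And>i t. periodic (\<lambda>x. \<phi> i (x, t))"
    and bound: "\<And>i z. \<phi> i z \<le> B" and init: "\<And>i x. \<phi> i (x, a) \<le> M"
    and gt: "\<phi> i1 (x1, b) > M" "a \<le> b"
  obtains \<kappa> i x \<tau> where "\<kappa> > 0" "a < \<tau>"
    "\<And>j y t. a \<le> t \<Longrightarrow> \<phi> j (y, t) - \<kappa> * t \<le> \<phi> i (x, \<tau>) - \<kappa> * \<tau>"
proof -
  have "a < b" using gt init[of i1 x1] by (cases "a = b") auto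
  \<comment> \<open>With this slope the penalty eats only half of the excess of the value at b over
    M.\<close>
  define \<kappa> where "\<kappa> = (\<phi> i1 (x1, b) - M) / (2 * (b - a))"
  have "\<kappa> > 0" using gt(1) \<open>a < b\<close> by (simp add: \<kappa>_def)
  have b_gt: "\<phi> i1 (x1, b) - \<kappa> * b > M - \<kappa> * a"
  proof -
    have "\<kappa> * (b - a) = (\<phi> i1 (x1, b) - M) / 2" using \<open>a < b\<close> by (simp add: \<kappa>_def field_simps)
    then show ?thesis using gt(1) by (simp add: right_diff_distrib)
  qed
  \<comment> \<open>Beyond this time the penalty outweighs the bound B, so a maximum over the
    compact interval is a maximum over all later times as well.\<close>
  define c where "c = max b (a + (B - M) / \<kappa>)"
  have "{a..c} \<noteq> {}" using \<open>a < b\<close> by (auto simp: c_def)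
  then obtain i x \<tau> where \<tau>: "\<tau> \<in> {a..c}"
    and mx: "\<And>j y s. s \<in> {a..c} \<Longrightarrow> \<phi> j (y, s) - \<kappa> * s \<le> \<phi> i (x, \<tau>) - \<kappa> * \<tau>"
  proof (rule periodic_attains_max[of "{a..c}" "\<lambda>j z. \<phi> j z - \<kappa> * snd z", rotated])
    show "continuous_on UNIV (\<lambda>z. \<phi> j z - \<kappa> * snd z)" for j
      by (intro continuous_intros cont)
    show "periodic (\<lambda>x. \<phi> j (x, t) - \<kappa> * snd (x, t))" for j t
      using per[of j t] by (simp add: periodic_def)
  qed auto
  have M: "M - \<kappa> * a < \<phi> i (x, \<tau>) - \<kappa> * \<tau>"
    using b_gt mx[of b i1 x1] \<open>a < b\<close> by (auto simp: c_def)
  show ?thesis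
  proof (rule that)
    show "a < \<tau>" using M init[of i x] \<tau> by (cases "a = \<tau>") auto
    fix j y t assume "a \<le> t"
    show "\<phi> j (y, t) - \<kappa> * t \<le> \<phi> i (x, \<tau>) - \<kappa> * \<tau>"
    proof (cases "t \<le> c")
      case False
      then have "(B - M) / \<kappa> < t - a" by (auto simp: c_def)
      then have "B - M < \<kappa> * (t - a)" using \<open>\<kappa> > 0\<close> by (simp add: pos_divide_less_eq mult.commute)
      then show ?thesis using bound[of j "(y, t)"] M by (simp add: right_diff_distrib)
    qed (use mx \<open>a \<le> t\<close> in auto)
  qed fact
qed

text \<open>The maximum available is over equal times, whereas \<open>doubling\<close> perturbs the
  two times independently. If one of the functions does not depend on time, its time argument may be
  moved freely, which reconciles the two.\<close>

lemma comparison_stationary: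
  fixes f g :: "(real^'n) \<times> real \<Rightarrow> real^'m"
  assumes H: "\<And>i. continuous_on UNIV (\<lambda>(x, p). H i x p)" and D: "monotone_matrix D"
    and f: "viscosity_subsolution (UNIV \<times> {a<..}) (evolution_op H D) f" "L-lipschitz_on UNIV f"
      "\<And>t. periodic (\<lambda>x. f (x, t))" "\<And>z. norm (f z) \<le> B"
    and g: "viscosity_supersolution (UNIV \<times> {a<..}) (evolution_op H D) g" "L-lipschitz_on UNIV g"
      "\<And>t. periodic (\<lambda>x. g (x, t))" "\<And>z. norm (g z) \<le> B"
    and stat: "(\<forall>x t s. f (x, t) = f (x, s)) \<or> (\<forall>x t s. g (x, t) = g (x, s))"
    and T: "a < T" "\<And>x i. f (x, T) $ i - g (x, T) $ i \<le> M" "T \<le> t"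
  shows "f (x, t) $ i - g (x, t) $ i \<le> M"
proof (rule ccontr)
  assume "\<not> ?thesis"
  then have gt: "f (x, t) $ i - g (x, t) $ i > M" by simp
  obtain \<kappa> i x \<tau> where \<kappa>: "\<kappa> > 0" "T < \<tau>" and mx: "\<And>j y t. T \<le> t \<Longrightarrow>
      (f (y, t) $ j - g (y, t) $ j) - \<kappa> * t \<le> (f (x, \<tau>) $ i - g (x, \<tau>) $ i) - \<kappa> * \<tau>"
  proof (rule infinite_horizon_max[of "\<lambda>i z. f z $ i - g z $ i" "B + B" T M i x t])
    show "continuous_on UNIV (\<lambda>z. f z $ i - g z $ i)" for i
      using f(2) g(2) by (intro continuous_intros lipschitz_on_continuous_on)
    show "periodic (\<lambda>x. f (x, t) $ i - g (x, t) $ i)" for i t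
      using f(3)[of t] g(3)[of t] by (simp add: periodic_def)
    show "f z $ i - g z $ i \<le> B + B" for i z
      using f(4)[of z] g(4)[of z] component_le_norm_cart[of "f z" i] component_le_norm_cart[of "g z" i]
      by linarith
  qed (use T gt in auto)
  \<comment> \<open>The whole slope \<kappa> is given to the function that may depend on time. Only
    \<open>p + q = \<kappa>\<close> enters the final contradiction.\<close>
  define p where "p = (if \<forall>x t s. g (x, t) = g (x, s) then \<kappa> else 0)"
  define q where "q = \<kappa> - p"
  obtain P where P: "p / 1 + H i x ((1 / 1) *\<^sub>R P) + (D *v f (x, \<tau>)) $ i \<le> 0"
    "0 \<le> - q + H i x P + (D *v g (x, \<tau>)) $ i"
  proof (rule doubling[where r = "\<tau> - T" and ?t0.0 = \<tau> and ?s0.0 = \<tau> and ?x0.0 = x and \<mu> = 1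
        and i = i and a = p and b = q, OF H f(1) _ g(1,2)])
    show "continuous_on UNIV f" using f(2) by (rule lipschitz_on_continuous_on)
    have "y \<in> UNIV \<times> {a<..}" if "y \<in> ball (x, \<tau>) (\<tau> - T)" for y
      using that dist_snd_le[of "(x, \<tau>)" y] T(1) by (auto simp: dist_real_def mem_Times_iff)
    then show "ball (x, \<tau>) (\<tau> - T) \<subseteq> UNIV \<times> {a<..}" "ball (x, \<tau>) (\<tau> - T) \<subseteq> UNIV \<times> {a<..}"
      by auto
    fix y t s assume ts: "\<bar>t - \<tau>\<bar> \<le> \<tau> - T" "\<bar>s - \<tau>\<bar> \<le> \<tau> - T"
    show "1 * f (y, t) $ i - g (y, s) $ i - p * t - q * s \<le> 1 * f (x, \<tau>) $ i - g (x, \<tau>) $ i - p * \<tau> - q * \<tau>"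
    proof (cases "\<forall>x t s. g (x, t) = g (x, s)")
      case True
      then have "g (y, s) = g (y, t)" by blast
      moreover have "p = \<kappa>" "q = 0" using True by (auto simp: p_def q_def)
      ultimately show ?thesis using mx[of t y i] ts(1) by simp
    next
      case False
      then have "f (y, t) = f (y, s)" using stat by blast
      moreover have "p = 0" "q = \<kappa>" using False by (auto simp: p_def q_def)
      ultimately show ?thesis using mx[of s y i] ts(2) by simp
    qed
  qed (use \<kappa> in auto)
  have "0 \<le> (D *v (f (x, \<tau>) - g (x, \<tau>))) $ i"
    using mx[of \<tau> x] \<kappa>(2) by (intro monotone_matrix_row_nonneg[OF D]) auto
  then show False
    using P \<kappa>(1) by (simp add: matrix_vector_mult_diff_distrib q_def)
qed

text \<open>The Arzela-Ascoli argument in pointwise form: a diagonal subsequence converges on a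
  countable dense set, and the common Lipschitz constant transfers the Cauchy property to all
  points.\<close>

lemma lipschitz_convergent_subsequence:
  fixes f :: "nat \<Rightarrow> 'a::euclidean_space \<Rightarrow> 'b::euclidean_space"
  assumes lip: "\<And>n. L-lipschitz_on UNIV (f n)" and B: "\<And>n z. norm (f n z) \<le> B"
  obtains r g where "strict_mono (r :: nat \<Rightarrow> nat)" "\<And>z. (\<lambda>n. f (r n) z) \<longlonglongrightarrow> g z"
proof -
  have L: "L \<ge> 0" using lip by (rule lipschitz_on_nonneg)
  obtain Q :: "'a set" where Q: "countable Q" "\<And>X. open X \<Longrightarrow> X \<noteq> {} \<Longrightarrow> \<exists>d\<in>Q. d \<in> X"
    by (metis countable_dense_setE)
  obtain r where r: "strict_mono (r :: nat \<Rightarrow> nat)" "\<And>x. x \<in> Q \<Longrightarrow> \<exists>l. (\<lambda>n. f (r n) x) \<longlonglongrightarrow> l"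
    using function_convergent_subsequence[of Q f B] Q(1) B by metis
  have "convergent (\<lambda>n. f (r n) z)" for z
  proof (rule Cauchy_convergent, rule metric_CauchyI)
    fix e :: real assume "e > 0"
    define d where "d = e / (3 * (L + 1))"
    have d: "d > 0" "L * d < e / 3"
      using \<open>e > 0\<close> L by (auto simp: d_def field_simps)
    obtain y where y: "y \<in> Q" "dist z y < d"
      using Q(2)[of "ball z d"] d(1) by auto
    then have "Cauchy (\<lambda>n. f (r n) y)"
      using r(2) LIMSEQ_imp_Cauchy by blast
    then obtain N where N: "\<And>m n. m \<ge> N \<Longrightarrow> n \<ge> N \<Longrightarrow> dist (f (r m) y) (f (r n) y) < e / 3"
      using \<open>e > 0\<close> unfolding Cauchy_def by (meson divide_pos_pos zero_less_numeral)
    have c: "dist (f n z) (f n y) < e / 3" for n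
    proof -
      have "dist (f n z) (f n y) \<le> L * dist z y" by (rule lipschitz_onD[OF lip]) auto
      also have "\<dots> \<le> L * d" using y L by (intro mult_left_mono) auto
      finally show ?thesis using d by simp
    qed
    have "dist (f (r m) z) (f (r n) z) < e" if "m \<ge> N" "n \<ge> N" for m n
      using c[of "r m"] c[of "r n"] N[OF that]
        dist_triangle[of "f (r m) z" "f (r n) z" "f (r m) y"]
        dist_triangle[of "f (r m) y" "f (r n) z" "f (r n) y"]
      by (simp add: dist_commute)
    then show "\<exists>M. \<forall>m\<ge>M. \<forall>n\<ge>M. dist (f (r m) z) (f (r n) z) < e" by blast
  qed
  then show ?thesis
    using r(1) that[of r "\<lambda>z. lim (\<lambda>n. f (r n) z)"] by (simp add: convergent_LIMSEQ_iff)
qed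

lemma periodic_limit:
  fixes F :: "nat \<Rightarrow> real^'n \<Rightarrow> 'b::t2_space"
  assumes "\<And>n. periodic (F n)" "\<And>x. (\<lambda>n. F n x) \<longlonglongrightarrow> G x"
  shows "periodic G"
  unfolding periodic_def
proof (intro allI impI)
  fix x k :: "real^'n" assume "\<forall>l. k $ l \<in> \<int>"
  then have "F n (x + k) = F n x" for n using assms(1)[of n] by (simp add: periodic_def)
  then show "G (x + k) = G x"
    using assms(2)[of "x + k"] LIMSEQ_unique[OF assms(2)[of x]] by simp
qed

lemma periodic_uniform_limit:
  fixes F :: "nat \<Rightarrow> real^'n \<Rightarrow> 'b::metric_space"
  assumes lip: "\<And>n. L-lipschitz_on UNIV (F n)" and per: "\<And>n. periodic (F n)"
    and lim: "\<And>x. (\<lambda>n. F n x) \<longlonglongrightarrow> G x"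
  shows "uniform_limit UNIV F G sequentially"
proof (rule uniform_limitI)
  fix e :: real assume "e > 0"
  have "uniform_limit (cbox 0 1) F G sequentially"
    by (rule lipschitz_pointwise_limit_uniform[OF compact_cbox lip lim])
  then have "\<forall>\<^sub>F n in sequentially. \<forall>x\<in>cbox 0 1. dist (F n x) (G x) < e"
    using \<open>e > 0\<close> by (rule uniform_limitD)
  then show "\<forall>\<^sub>F n in sequentially. \<forall>x\<in>UNIV. dist (F n x) (G x) < e"
  proof eventually_elim
    case (elim n)
    have "dist (F n x) (G x) < e" for x
    proof -
      obtain k where k: "\<And>f :: real^'n \<Rightarrow> 'b. periodic f \<Longrightarrow> f (x + k) = f x" "x + k \<in> cbox 0 1"
        using periodic_cube by blast
      show ?thesis using elim k(2) k(1)[OF per] k(1)[OF periodic_limit[OF per lim]] by fastforce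
    qed
    then show ?case by simp
  qed
qed

lemma viscosity_subsolution_translate:
  fixes f :: "'a::real_inner \<Rightarrow> real^'m"
  assumes F: "\<And>i z. F i (z + h) = F i z" and f: "viscosity_subsolution \<Omega> F f"
  shows "viscosity_subsolution {z. z + h \<in> \<Omega>} F (\<lambda>z. f (z + h))"
  unfolding viscosity_subsolution_def
proof (intro allI impI, elim conjE)
  fix i S \<phi> G y
  assume S: "open S" "S \<subseteq> {z. z + h \<in> \<Omega>}" "y \<in> S" and C1: "C1_on S \<phi> G"
    and mx: "\<forall>z\<in>S. f (z + h) $ i - \<phi> z \<le> f (y + h) $ i - \<phi> y"
  let ?S = "(\<lambda>z. z - h) -` S"
  have C1': "C1_on ?S (\<lambda>z. \<phi> (z - h)) (\<lambda>z. G (z - h))"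
    unfolding C1_on_def
  proof
    show "\<forall>z\<in>?S. GDERIV (\<lambda>z. \<phi> (z - h)) z :> G (z - h)"
    proof
      fix z assume "z \<in> ?S"
      then have "(\<phi> has_derivative (\<lambda>v. v \<bullet> G (z - h))) (at (z - h))"
        using C1 by (simp add: C1_on_def gderiv_def)
      then show "GDERIV (\<lambda>z. \<phi> (z - h)) z :> G (z - h)"
        unfolding gderiv_def
        by (rule has_derivative_compose[rotated]) (auto intro!: derivative_eq_intros)
    qed
    show "continuous_on ?S (\<lambda>z. G (z - h))"
      using C1 by (auto simp: C1_on_def intro!: continuous_on_compose2[of S G] continuous_intros)
  qed
  have "F i (y + h) (f (y + h)) (G (y + h - h)) \<le> 0"
  proof (rule f[unfolded viscosity_subsolution_def, rule_format, of ?S "y + h" "\<lambda>z. \<phi> (z - h)"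
        "\<lambda>z. G (z - h)" i], intro conjI C1')
    show "open ?S" using S(1) by (intro open_vimage continuous_intros)
    show "?S \<subseteq> \<Omega>" using S(2) by force
    show "\<forall>z\<in>?S. f z $ i - \<phi> (z - h) \<le> f (y + h) $ i - \<phi> (y + h - h)"
      using mx by (metis vimageE add_diff_cancel_right' diff_add_cancel)
  qed (use S in auto)
  then show "F i y (f (y + h)) (G y) \<le> 0" by (simp add: F)
qed

lemma viscosity_supersolution_translate:
  fixes f :: "'a::real_inner \<Rightarrow> real^'m"
  assumes F: "\<And>i z. F i (z + h) = F i z" and f: "viscosity_supersolution \<Omega> F f"
  shows "viscosity_supersolution {z. z + h \<in> \<Omega>} F (\<lambda>z. f (z + h))"
  using viscosity_subsolution_translate[of "\<lambda>i z r q. - F i z (- r) (- q)" h \<Omega> "\<lambda>z. - f z"] assms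
  unfolding viscosity_supersolution_uminus by simp

text \<open>A test function in space, extended constantly in time, is an admissible test function in
  space-time with vanishing time derivative.\<close>

lemma stationary_solution_if_evolution:
  fixes v :: "real^'n \<Rightarrow> real^'m"
  assumes per: "periodic v" and cont: "continuous_on UNIV v"
    and sub: "viscosity_subsolution UNIV (evolution_op H D) (\<lambda>z. v (fst z))"
    and sup: "viscosity_supersolution UNIV (evolution_op H D) (\<lambda>z. v (fst z))"
  shows "stationary_solution H D v"
proof -
  have C1: "C1_on (S \<times> UNIV) (\<lambda>z :: (real^'n) \<times> real. \<phi> (fst z)) (\<lambda>z. (G (fst z), 0))"
    if "C1_on S \<phi> G" for S \<phi> and G :: "real^'n \<Rightarrow> real^'n"
    unfolding C1_on_def
  proof
    show "\<forall>z\<in>S \<times> UNIV. GDERIV (\<lambda>z :: (real^'n) \<times> real. \<phi> (fst z)) z :> (G (fst z), 0)"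
    proof
      fix z :: "(real^'n) \<times> real" assume "z \<in> S \<times> UNIV"
      then have "(\<phi> has_derivative (\<lambda>v. v \<bullet> G (fst z))) (at (fst z))"
        using that by (auto simp: C1_on_def gderiv_def)
      then have "((\<lambda>z. \<phi> (fst z)) has_derivative (\<lambda>v. fst v \<bullet> G (fst z))) (at z)"
        by (rule has_derivative_compose[rotated]) (auto intro!: derivative_eq_intros)
      then show "GDERIV (\<lambda>z. \<phi> (fst z)) z :> (G (fst z), 0)"
        by (simp add: gderiv_def inner_prod_def)
    qed
    show "continuous_on (S \<times> UNIV) (\<lambda>z. (G (fst z), 0::real))"
      using that by (auto simp: C1_on_def intro!: continuous_on_compose2[of S G] continuous_intros)
  qed
  have "viscosity_subsolution UNIV (\<lambda>i x r p. H i x p + (\<Sum>j\<in>UNIV. D $ i $ j * r $ j)) v"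
    unfolding viscosity_subsolution_def
  proof (intro allI impI, elim conjE)
    fix i S \<phi> G y
    assume "open S" "y \<in> S" "C1_on S \<phi> G" "\<forall>z\<in>S. v z $ i - \<phi> z \<le> v y $ i - \<phi> y"
    then show "H i y (G y) + (\<Sum>j\<in>UNIV. D $ i $ j * v y $ j) \<le> 0"
      using sub[unfolded viscosity_subsolution_def, rule_format, of "S \<times> UNIV" "(y, 0)"
          "\<lambda>z. \<phi> (fst z)" "\<lambda>z. (G (fst z), 0)" i] C1 by (auto simp: open_Times)
  qed
  moreover have "viscosity_supersolution UNIV (\<lambda>i x r p. H i x p + (\<Sum>j\<in>UNIV. D $ i $ j * r $ j)) v"
    unfolding viscosity_supersolution_def
  proof (intro allI impI, elim conjE)
    fix i S \<phi> G y
    assume "open S" "y \<in> S" "C1_on S \<phi> G" "\<forall>z\<in>S. v y $ i - \<phi> y \<le> v z $ i - \<phi> z"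
    then show "0 \<le> H i y (G y) + (\<Sum>j\<in>UNIV. D $ i $ j * v y $ j)"
      using sup[unfolded viscosity_supersolution_def, rule_format, of "S \<times> UNIV" "(y, 0)"
          "\<lambda>z. \<phi> (fst z)" "\<lambda>z. (G (fst z), 0)" i] C1 by (auto simp: open_Times)
  qed
  ultimately show ?thesis
    using per cont by (simp add: stationary_solution_def viscosity_solution_def)
qed

subsection \<open>Limits of time translates\<close>

text \<open>The bounds on f hold for all real times although the equation is required only after a0.
  All translates of f then live on one domain with one Lipschitz constant, and only the equation has
  to be tracked on moving domains. The Hamiltonian enters through the integrated inequalities, valid
  at every point.\<close>

locale weakly_coupled_evolution =
  fixes D :: "real^'m^'m" and H :: "'m \<Rightarrow> real^'n \<Rightarrow> real^'n \<Rightarrow> real"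
    and K :: "(real^'n) set" and f :: "(real^'n) \<times> real \<Rightarrow> real^'m" and L B a0 :: real
  assumes D: "monotone_matrix D" "irreducible_matrix D"
    and H_cont: "\<And>i. continuous_on UNIV (\<lambda>(x, p). H i x p)"
    and H_hom: "\<And>i x p l. 1 \<le> l \<Longrightarrow> l * H i x p \<le> H i x (l *\<^sub>R p)"
    and H_strict: "\<And>i x p l. x \<notin> K \<Longrightarrow> 0 < H i x p \<Longrightarrow> 1 < l \<Longrightarrow> l * H i x p < H i x (l *\<^sub>R p)"
    and H_nonneg: "\<And>i x p. x \<in> K \<Longrightarrow> 0 \<le> H i x p"
    and lip: "L-lipschitz_on UNIV f"
    and bound: "\<And>z. norm (f z) \<le> B"
    and per: "\<And>t. periodic (\<lambda>x. f (x, t))"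
    and sub: "viscosity_subsolution (UNIV \<times> {a0<..}) (evolution_op H D) f"
    and sup: "viscosity_supersolution (UNIV \<times> {a0<..}) (evolution_op H D) f"
begin

lemma bound_component: "norm (g z) \<le> B \<Longrightarrow> - B \<le> g z $ i \<and> g z $ i \<le> B" for g :: "'c \<Rightarrow> real^'m"
  using component_le_norm_cart[of "g z" i] by linarith

text \<open>Pointwise convergence is enough because the translates are equi-Lipschitz. The sequence
  of times is kept as a parameter so that bounds on f at large times can be passed on to w.\<close>

definition omega_limit :: "(nat \<Rightarrow> real) \<Rightarrow> ((real^'n) \<times> real \<Rightarrow> real^'m) \<Rightarrow> bool" where
  "omega_limit ts w \<longleftrightarrow> filterlim ts at_top sequentially \<and> (\<forall>z. (\<lambda>n. f (z + (0, ts n))) \<longlonglongrightarrow> w z)"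

lemma lipschitz_shift: "L-lipschitz_on UNIV (\<lambda>z. f (z + (0, T)))"
proof (rule lipschitz_onI)
  show "0 \<le> L" using lip by (rule lipschitz_on_nonneg)
  show "dist (f (x + (0, T))) (f (y + (0, T))) \<le> L * dist x y" for x y
    using lipschitz_onD[OF lip, of "x + (0, T)" "y + (0, T)"] by simp
qed

lemma omega_limit_exists:
  assumes "filterlim ts at_top sequentially"
  obtains r w where "strict_mono r" "omega_limit (ts \<circ> r) w"
proof -
  obtain r w where r: "strict_mono (r :: nat \<Rightarrow> nat)" "\<And>z. (\<lambda>n. f (z + (0, ts (r n)))) \<longlonglongrightarrow> w z"
    using lipschitz_convergent_subsequence[of L "\<lambda>n z. f (z + (0, ts n))" B, OF lipschitz_shift bound]
    by blast
  moreover have "filterlim (\<lambda>n. ts (r n)) at_top sequentially"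
    using filterlim_compose[OF assms filterlim_subseq[OF r(1)]] .
  ultimately show ?thesis using that[of r w] unfolding omega_limit_def o_def by blast
qed

context
  fixes ts w assumes w: "omega_limit ts w"
begin

lemma omega_limit_tendsto: "(\<lambda>n. f (z + (0, ts n))) \<longlonglongrightarrow> w z"
  using w unfolding omega_limit_def by blast

lemma omega_limit_lipschitz: "L-lipschitz_on UNIV w"
  using lipschitz_shift omega_limit_tendsto by (rule lipschitz_on_limit)

lemma omega_limit_bound: "norm (w z) \<le> B"
  using tendsto_norm[OF omega_limit_tendsto] by (rule LIMSEQ_le_const2) (use bound in auto)

lemma omega_limit_periodic: "periodic (\<lambda>x. w (x, t))"
  by (rule periodic_limit[where F = "\<lambda>n x. f (x, t + ts n)"])
     (use per omega_limit_tendsto[of "(_, t)"] in auto)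

text \<open>The shifted half-spaces exhaust space-time, which is why the limits solve the system for
  all real times. The added 1 in the proof is the radius of the ball.\<close>

lemma omega_limit_domain:
  "\<exists>r>0. \<forall>\<^sub>F n in sequentially. ball z r \<subseteq> {z. z + (0, ts n) \<in> UNIV \<times> {a0<..}}"
proof (intro exI conjI)
  have "\<forall>\<^sub>F n in sequentially. a0 + 1 - snd z \<le> ts n"
    using w by (auto simp: omega_limit_def filterlim_at_top)
  then show "\<forall>\<^sub>F n in sequentially. ball z 1 \<subseteq> {z. z + (0, ts n) \<in> UNIV \<times> {a0<..}}"
  proof eventually_elim
    case (elim n)
    have "a0 < snd y + ts n" if "dist z y < 1" for y
      using that dist_snd_le[of z y] elim by (simp add: dist_real_def)
    then show ?case by (auto simp: mem_Times_iff)
  qed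
qed simp

lemma omega_limit_sub: "viscosity_subsolution UNIV (evolution_op H D) w"
  using continuous_on_evolution_op[OF H_cont] lipschitz_shift omega_limit_tendsto _ omega_limit_domain
  by (rule viscosity_subsolution_limit) (rule viscosity_subsolution_translate[OF _ sub], simp add: case_prod_beta)

lemma omega_limit_sup: "viscosity_supersolution UNIV (evolution_op H D) w"
  using continuous_on_evolution_op[OF H_cont] lipschitz_shift omega_limit_tendsto _ omega_limit_domain
  by (rule viscosity_supersolution_limit) (rule viscosity_supersolution_translate[OF _ sup], simp add: case_prod_beta)

end

section \<open>Behaviour of the solution over the set K\<close>

lemma max_nonincreasing_on_K:
  assumes x: "x \<in> K" and a: "a0 < a" and M: "\<And>j. f (x, a) $ j \<le> M" and "a \<le> b"
  shows "f (x, b) $ i \<le> M"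
proof (rule ccontr)
  assume "\<not> ?thesis"
  then have gt: "f (x, b) $ i > M" by simp
  obtain \<kappa> i y \<tau> where \<kappa>: "\<kappa> > 0" "a < \<tau>" and mx: "\<And>j (y' :: real^'n) t. a \<le> t \<Longrightarrow>
      f (x, t) $ j - \<kappa> * t \<le> f (x, \<tau>) $ i - \<kappa> * \<tau>"
  \<comment> \<open>The point x is frozen: the functions passed on ignore their space variable and
    are trivially periodic.\<close>
  proof (rule infinite_horizon_max[of "\<lambda>j z. f (x, snd z) $ j" B a M i x b])
    show "continuous_on UNIV (\<lambda>z :: (real^'n) \<times> real. f (x, snd z) $ j)" for j
      by (intro continuous_intros continuous_on_compose2[OF lipschitz_on_continuous_on[OF lip]]) auto
    show "f (x, snd z) $ j \<le> B" for j and z :: "(real^'n) \<times> real"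
      using bound_component[of f, OF bound] by blast
  qed (use M gt \<open>a \<le> b\<close> in \<open>auto simp: periodic_def\<close>)
  \<comment> \<open>At a point of K the system gives, formally, that the time derivative of
    component i is at most minus its coupling term. For the largest component the coupling term is
    nonnegative, which is incompatible with the positive slope \<kappa>.\<close>
  have "\<kappa> + (D *v f (x, \<tau>)) $ i \<le> 0"
  proof (rule subsolution_in_time[where r = "\<tau> - a", OF H_cont sub lip])
    have "y \<in> UNIV \<times> {a0<..}" if "y \<in> ball (x, \<tau>) (\<tau> - a)" for y
      using that dist_snd_le[of "(x, \<tau>)" y] a by (auto simp: dist_real_def mem_Times_iff)
    then show "ball (x, \<tau>) (\<tau> - a) \<subseteq> UNIV \<times> {a0<..}" by auto
    show "f (x, t) $ i - \<kappa> * t \<le> f (x, \<tau>) $ i - \<kappa> * \<tau>" if "\<bar>t - \<tau>\<bar> \<le> \<tau> - a" for t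
      using that by (intro mx) auto
  qed (use \<kappa> H_nonneg x in auto)
  moreover have "0 \<le> (D *v f (x, \<tau>)) $ i"
    using mx[of \<tau>] \<kappa>(2) by (intro monotone_matrix_row_nonneg[OF D(1)]) auto
  ultimately show False using \<kappa>(1) by simp
qed

text \<open>On K the largest component of an omega-limit does not depend on time, so it is attained
  at an interior maximum in time of some component; the coupling then propagates the maximum.\<close>

lemma omega_limit_constant_on_K:
  assumes w: "omega_limit ts w" and x: "x \<in> K"
  obtains M where "\<And>t i. w (x, t) $ i = M"
proof -
  define m where "m t = Max (range (\<lambda>i. f (x, t) $ i))" for t
  have m: "f (x, t) $ i \<le> m t" for t i
    unfolding m_def by (rule Max_ge) auto
  have m_ex: "\<exists>i. f (x, t) $ i = m t" for t
  proof -
    have "m t \<in> range (\<lambda>i. f (x, t) $ i)" unfolding m_def by (rule Max_in) auto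
    then show ?thesis by auto
  qed
  \<comment> \<open>As m is nonincreasing after a0, this infimum is its limit, and hence the value
    of the largest component of w at every time.\<close>
  define M where "M = Inf (m ` {a0<..})"
  have bdd: "bdd_below (m ` {a0<..})"
  proof (rule bdd_belowI2)
    fix t show "- B \<le> m t" using m_ex[of t] bound_component[of f, OF bound] by metis
  qed
  have le: "w (x, t) $ j \<le> M" for t j
  proof (rule field_le_epsilon)
    fix e :: real assume "e > 0"
    then obtain \<tau> where \<tau>: "a0 < \<tau>" "m \<tau> < M + e"
      using cInf_lessD[of "m ` {a0<..}" "M + e"] by (auto simp: M_def)
    have "\<forall>\<^sub>F n in sequentially. \<tau> - t \<le> ts n"
      using w by (auto simp: omega_limit_def filterlim_at_top)
    then have "\<forall>\<^sub>F n in sequentially. f ((x, t) + (0, ts n)) $ j \<le> m \<tau>"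
      by eventually_elim (use max_nonincreasing_on_K[OF x \<tau>(1) m] in auto)
    then have "w (x, t) $ j \<le> m \<tau>"
      by (rule tendsto_upperbound[OF tendsto_vec_nth[OF omega_limit_tendsto[OF w]]]) simp
    then show "w (x, t) $ j \<le> M + e" using \<tau>(2) by simp
  qed
  have ex: "\<exists>i. w (x, t) $ i = M" for t
  proof (rule ccontr)
    assume "\<nexists>i. w (x, t) $ i = M"
    then have "w (x, t) $ i < M" for i using le[of t i] by (simp add: less_le)
    then have "\<forall>\<^sub>F n in sequentially. f ((x, t) + (0, ts n)) $ i < M" for i
      using order_tendstoD(2)[OF tendsto_vec_nth[OF omega_limit_tendsto[OF w]]] by blast
    then have "\<forall>\<^sub>F n in sequentially. \<forall>i. f ((x, t) + (0, ts n)) $ i < M"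
      by (rule eventually_all_finite)
    moreover have "\<forall>\<^sub>F n in sequentially. a0 + 1 - t \<le> ts n"
      using w by (auto simp: omega_limit_def filterlim_at_top)
    ultimately have "\<forall>\<^sub>F n in sequentially. False"
    proof eventually_elim
      case (elim n)
      obtain i where "f (x, t + ts n) $ i = m (t + ts n)" using m_ex by blast
      moreover have "M \<le> m (t + ts n)"
        unfolding M_def using bdd elim by (intro cInf_lower) auto
      ultimately show False using elim(1) by (metis add_Pair add.right_neutral not_less)
    qed
    then show False by simp
  qed
  have "w (x, t) $ j = M" for t j
  proof -
    obtain i0 where "w (x, t) $ i0 = M" using ex by blast
    with D le show ?thesis
    proof (rule irreducible_matrix_max_principle)
      fix i assume i: "w (x, t) $ i = M"
      \<comment> \<open>Slope 0 is admissible: M bounds the component at all times, so every time at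
        which it equals M is a maximum in time.\<close>
      have "0 + (D *v w (x, t)) $ i \<le> 0"
        by (rule subsolution_in_time[where r = 1, OF H_cont omega_limit_sub[OF w] omega_limit_lipschitz[OF w]])
           (use H_nonneg x i le in auto)
      then show "(D *v w (x, t)) $ i \<le> 0" by simp
    qed
  qed
  then show ?thesis using that by blast
qed

section \<open>Contact points and the asymptotic ratio\<close>

lemma no_contact:
  assumes w: "omega_limit ts w" and l: "0 < l" "l < 1" and \<eta>: "0 < \<eta>" and c: "B + 1 \<le> c"
    and ineq: "\<And>x t s i. t \<le> s \<Longrightarrow> l * (w (x, t) $ i + c) \<le> w (x, s) $ i + c + \<eta> * (s - t)"
    and \<sigma>: "0 \<le> \<sigma>"
    and contact: "w (x, \<sigma>) $ i0 + c + \<eta> * \<sigma> \<le> l * (w (x, 0) $ i0 + c)"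
  shows False
proof -
  have pos: "1 \<le> w z $ i + c" for z i
    using bound_component[of w, OF omega_limit_bound[OF w], of z i] c by linarith
  have lt: "l * (w z $ i + c) < w z $ i + c" for z i
    using mult_strict_right_mono[OF l(2), of "w z $ i + c"] pos[of z i] by simp
  \<comment> \<open>At equal times contact contradicts \<open>l < 1\<close> and positivity. A
    positive \<sigma> leaves room to vary both times independently.\<close>
  have "\<sigma> > 0"
    using contact lt[of "(x, 0)" i0] \<sigma> by (cases "\<sigma> = 0") auto
  \<comment> \<open>The inequality says that M bounds all components of r, and contact says that the
    bound is attained, so the maximum principle for D applies. M collects the contributions of the
    shift c and of \<eta>.\<close>
  define r where "r = l *\<^sub>R w (x, 0) - w (x, \<sigma>)"
  define M where "M = (1 - l) * c + \<eta> * \<sigma>"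
  have r_le: "r $ j \<le> M" for j
    using ineq[OF \<sigma>, of x j] by (simp add: r_def M_def algebra_simps)
  have r_i0: "r $ i0 = M"
    using contact r_le[of i0] by (simp add: r_def M_def algebra_simps)
  have test: "\<exists>P. H i x P + l * (D *v w (x, 0)) $ i \<le> \<eta> \<and> \<eta> \<le> H i x P + (D *v w (x, \<sigma>)) $ i
      \<and> (x \<notin> K \<and> H i x P > 0 \<longrightarrow> H i x P + l * (D *v w (x, 0)) $ i < \<eta>)"
    if i: "r $ i = M" for i
  proof -
    obtain P where P: "- \<eta> / l + H i x ((1 / l) *\<^sub>R P) + (D *v w (x, 0)) $ i \<le> 0"
      "0 \<le> - \<eta> + H i x P + (D *v w (x, \<sigma>)) $ i"
    proof (rule doubling[where r = "\<sigma> / 2" and ?t0.0 = 0 and ?s0.0 = \<sigma> and ?x0.0 = x and \<mu> = l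
        and i = i and a = "- \<eta>" and b = \<eta>, OF H_cont omega_limit_sub[OF w] _
        omega_limit_sup[OF w] omega_limit_lipschitz[OF w]])
      show "continuous_on UNIV w"
        using omega_limit_lipschitz[OF w] by (rule lipschitz_on_continuous_on)
      \<comment> \<open>With radius \<open>\<sigma> / 2\<close> about 0 and \<sigma> the two times
        stay in order, as \<open>ineq\<close> requires.\<close>
      fix y t s assume "\<bar>t - 0\<bar> \<le> \<sigma> / 2" "\<bar>s - \<sigma>\<bar> \<le> \<sigma> / 2"
      then have "t \<le> s" by linarith
      from ineq[OF this, of y i] i
      show "l * w (y, t) $ i - w (y, s) $ i - - \<eta> * t - \<eta> * s
          \<le> l * w (x, 0) $ i - w (x, \<sigma>) $ i - - \<eta> * 0 - \<eta> * \<sigma>"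
        by (simp add: r_def M_def algebra_simps)
    qed (use \<open>\<sigma> > 0\<close> l in auto)
    \<comment> \<open>Multiplication by l makes the term
      \<open>l * H i x ((1 / l) *\<^sub>R P)\<close> appear, which superhomogeneity with factor
      \<open>1 / l\<close> compares with \<open>H i x P\<close>.\<close>
    have "l * (- \<eta> / l + H i x ((1 / l) *\<^sub>R P) + (D *v w (x, 0)) $ i) \<le> 0"
      using P(1) l(1) by (simp add: mult_le_0_iff)
    then have "l * H i x ((1 / l) *\<^sub>R P) + l * (D *v w (x, 0)) $ i \<le> \<eta>"
      using l(1) by (simp add: algebra_simps)
    moreover have "H i x P \<le> l * H i x ((1 / l) *\<^sub>R P)"
      using H_hom[of "1 / l" i x P] l by (simp add: field_simps)
    moreover have "H i x P < l * H i x ((1 / l) *\<^sub>R P)" if "x \<notin> K" "H i x P > 0"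
      using H_strict[OF that, of "1 / l"] l by (simp add: field_simps)
    ultimately show ?thesis using P(2) by (intro exI[of _ P]) auto
  qed
  have Dr: "(D *v r) $ i = l * (D *v w (x, 0)) $ i - (D *v w (x, \<sigma>)) $ i" for i
    by (simp add: r_def matrix_vector_mult_diff_distrib matrix_vector_mult_scaleR)
  have r_eq: "r $ j = M" for j
    using D r_le r_i0
  proof (rule irreducible_matrix_max_principle)
    \<comment> \<open>Subtracting the two inequalities of \<open>test\<close> eliminates both the
      Hamiltonian and \<eta>.\<close>
    show "(D *v r) $ i \<le> 0" if "r $ i = M" for i
      using test[OF that] Dr[of i] by auto
  qed
  show False
  proof (cases "x \<in> K")
    case True
    then obtain m where "\<And>t i. w (x, t) $ i = m"
      using omega_limit_constant_on_K[OF w] by blast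
    then show False
      using contact lt[of "(x, 0)" i0] \<eta> \<open>\<sigma> > 0\<close> by (smt (verit) mult_pos_pos)
  next
    case False
    \<comment> \<open>For the smallest component the coupling term is nonpositive, so the
      supersolution inequality gives \<open>H i x P \<ge> \<eta> > 0\<close>. The strict case of
      \<open>test\<close> then makes row i of D negative on r, although r is a constant
      vector.\<close>
    obtain i where i: "\<And>j. w (x, \<sigma>) $ i \<le> w (x, \<sigma>) $ j"
    proof -
      have "Min (range (\<lambda>j. w (x, \<sigma>) $ j)) \<in> range (\<lambda>j. w (x, \<sigma>) $ j)" by (rule Min_in) auto
      then obtain i where "Min (range (\<lambda>j. w (x, \<sigma>) $ j)) = w (x, \<sigma>) $ i" by (rule rangeE)
      then show ?thesis using that[of i] by (metis Min_le finite finite_imageI rangeI)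
    qed
    have "0 \<le> (D *v (- w (x, \<sigma>))) $ i"
      using i by (intro monotone_matrix_row_nonneg[OF D(1)]) auto
    moreover have "(D *v (- w (x, \<sigma>))) $ i = - (D *v w (x, \<sigma>)) $ i"
      using matrix_vector_mult_scaleR[of D "- 1" "w (x, \<sigma>)"] by simp
    moreover have "0 \<le> (D *v r) $ i"
      using r_eq by (intro monotone_matrix_row_nonneg[OF D(1)]) auto
    ultimately show False
      using test[OF r_eq[of i]] Dr[of i] False \<eta> by auto
  qed
qed

text \<open>The best constant for which the inequality eventually holds is attained in a limit that
  exists for all times, where contact takes place at interior times.\<close>

lemma asymptotic_ratio:
  assumes l: "l < 1" and \<eta>: "0 < \<eta>"
  shows "\<forall>\<^sub>F t in at_top. \<forall>s\<ge>t. \<forall>x i.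
    l * (f (x, t) $ i + (B + 1)) \<le> f (x, s) $ i + (B + 1) + \<eta> * (s - t)"
proof (rule ccontr)
  define c where "c = B + 1"
  define good where "good l \<longleftrightarrow> (\<forall>\<^sub>F t in at_top. \<forall>s\<ge>t. \<forall>x i.
    l * (f (x, t) $ i + c) \<le> f (x, s) $ i + c + \<eta> * (s - t))" for l
  have fb: "1 \<le> f z $ i + c" "f z $ i + c \<le> B + c" for z i
    using bound_component[of f, OF bound, of z i] by (auto simp: c_def)
  have "B + c \<ge> 1" using fb[of undefined undefined] by linarith
  assume "\<not> ?thesis"
  then have not_good: "\<not> good l" by (simp add: good_def c_def)
  have good_mono: "good l'" if "good l''" "l' \<le> l''" for l' l''
    using that(1) unfolding good_def
  proof eventually_elim
    case (elim t)
    have "l' * (f (x, t) $ i + c) \<le> l'' * (f (x, t) $ i + c)" for x i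
      using that(2) fb(1)[of "(x, t)" i] by (intro mult_right_mono) auto
    then show ?case using elim by (meson order_trans)
  qed
  \<comment> \<open>All shifted values lie between 1 and \<open>B + c\<close>, so their ratios are
    at least \<open>1 / (B + c)\<close>. This keeps the optimal constant positive.\<close>
  have good_0: "good (1 / (B + c))"
    unfolding good_def
  proof (intro always_eventually allI impI)
    fix t s :: real and x i assume "t \<le> s"
    have "1 / (B + c) * (f (x, t) $ i + c) \<le> 1"
      using fb(2)[of "(x, t)" i] \<open>B + c \<ge> 1\<close> by (simp add: field_simps)
    also have "1 \<le> f (x, s) $ i + c" by (rule fb)
    finally show "1 / (B + c) * (f (x, t) $ i + c) \<le> f (x, s) $ i + c + \<eta> * (s - t)"
      using \<eta> \<open>t \<le> s\<close> by (simp add: add_increasing2)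
  qed
  define ls where "ls = Sup (Collect good)"
  have ub: "l' \<le> l" if "good l'" for l'
    using good_mono[OF that, of l] not_good by linarith
  then have bdd: "bdd_above (Collect good)" by (auto intro: bdd_aboveI[of _ l])
  have "ls \<le> l" unfolding ls_def using good_0 ub by (intro cSup_least) auto
  have "1 / (B + c) \<le> ls" unfolding ls_def using good_0 bdd by (intro cSup_upper) auto
  then have ls: "0 < ls" "ls < 1" using \<open>ls \<le> l\<close> l \<open>B + c \<ge> 1\<close>
    by (auto intro: less_le_trans[of 0 "1 / (B + c)"])
  \<comment> \<open>A sequence above the supremum, not the logarithm. Since none of its terms is
    good, the inequality is violated at arbitrarily late times.\<close>
  define ln where "ln n = ls + 1 / (real n + 1)" for n
  have "\<not> good (ln n)" for n
    using cSup_upper[OF _ bdd, of "ln n"] by (auto simp: ls_def[symmetric] ln_def)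
  then have "\<exists>t\<ge>real n. \<exists>s\<ge>t. \<exists>x i. f (x, s) $ i + c + \<eta> * (s - t) < ln n * (f (x, t) $ i + c)" for n
    unfolding good_def eventually_at_top_linorder by (meson not_le)
  then obtain ts ss xs js where viol: "\<And>n. real n \<le> ts n" "\<And>n. ts n \<le> ss n"
    "\<And>n. f (xs n, ss n) $ js n + c + \<eta> * (ss n - ts n) < ln n * (f (xs n, ts n) $ js n + c)"
    by metis
  have "\<exists>y\<in>cbox 0 1. f (y, ss n) $ js n + c + \<eta> * (ss n - ts n) < ln n * (f (y, ts n) $ js n + c)" for n
  proof -
    obtain k where k: "\<And>g :: real^'n \<Rightarrow> real^'m. periodic g \<Longrightarrow> g (xs n + k) = g (xs n)" "xs n + k \<in> cbox 0 1"
      using periodic_cube by blast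
    show ?thesis
      using viol(3)[of n] k(2) k(1)[OF per, of "ts n"] k(1)[OF per, of "ss n"] by (intro bexI[of _ "xs n + k"]) auto
  qed
  then obtain ys where ys: "\<And>n. ys n \<in> cbox 0 1"
    "\<And>n. f (ys n, ss n) $ js n + c + \<eta> * (ss n - ts n) < ln n * (f (ys n, ts n) $ js n + c)"
    by metis
  \<comment> \<open>The left side of a violated inequality grows like
    \<open>\<eta> * (ss n - ts n)\<close>, the right side is bounded. The 2 is an upper bound for
    \<open>ln n\<close>.\<close>
  have diff: "ss n - ts n \<in> {0..2 * (B + c) / \<eta>}" for n
  proof -
    have "1 / (real n + 1) \<le> 1" by simp
    then have "ln n \<le> 2" using ls unfolding ln_def by linarith
    then have "ln n * (f (ys n, ts n) $ js n + c) \<le> 2 * (B + c)"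
      using fb[of "(ys n, ts n)" "js n"] by (intro mult_mono) auto
    then have "\<eta> * (ss n - ts n) \<le> 2 * (B + c)"
      using ys(2)[of n] fb(1)[of "(ys n, ss n)" "js n"] by linarith
    then show ?thesis
      using viol(2)[of n] \<eta> by (simp add: pos_le_divide_eq mult.commute)
  qed
  have "filterlim ts at_top sequentially"
    using filterlim_at_top_mono[OF filterlim_real_sequentially] viol(1) by auto
  then obtain r1 w1 where r1: "strict_mono r1" "omega_limit (ts \<circ> r1) w1"
    by (rule omega_limit_exists)
  let ?z = "\<lambda>n. (ys (r1 n), ss (r1 n) - ts (r1 n))"
  have "\<forall>n. ?z n \<in> cbox 0 1 \<times> {0..2 * (B + c) / \<eta>}"
    using ys(1) diff by (auto simp: mem_Times_iff)
  then obtain z0 r2 where z0: "z0 \<in> cbox 0 1 \<times> {0..2 * (B + c) / \<eta>}"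
    and r2: "strict_mono (r2 :: nat \<Rightarrow> nat)" "(?z \<circ> r2) \<longlonglongrightarrow> z0"
    by (rule seq_compactE[OF compact_imp_seq_compact[OF compact_Times[OF compact_cbox compact_Icc]]])
  define r where "r = r1 \<circ> r2"
  have r: "strict_mono r" unfolding r_def using r1(1) r2(1) by (rule strict_mono_o)
  obtain x \<sigma> where x\<sigma>: "z0 = (x, \<sigma>)" by (metis surj_pair)
  have w: "omega_limit (ts \<circ> r) w1"
    using r1(2) r2(1) unfolding omega_limit_def r_def
    by (auto simp: o_def dest: filterlim_compose[OF _ filterlim_subseq] LIMSEQ_subseq_LIMSEQ)
  have lim_z: "(\<lambda>n. (ys (r n), ss (r n) - ts (r n))) \<longlonglongrightarrow> (x, \<sigma>)"
    using r2(2) by (simp add: r_def o_def x\<sigma>)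
  have lim_s: "(\<lambda>n. f (ys (r n), ss (r n))) \<longlonglongrightarrow> w1 (x, \<sigma>)"
    using lipschitz_tendsto_diagonal[OF lipschitz_shift omega_limit_tendsto[OF w] lim_z] by simp
  have lim_t: "(\<lambda>n. f (ys (r n), ts (r n))) \<longlonglongrightarrow> w1 (x, 0)"
    using lipschitz_tendsto_diagonal[OF lipschitz_shift omega_limit_tendsto[OF w]
      tendsto_Pair[OF tendsto_fst[OF lim_z] tendsto_const[of 0]]] by simp
  have lim_d: "(\<lambda>n. ss (r n) - ts (r n)) \<longlonglongrightarrow> \<sigma>"
    using tendsto_snd[OF lim_z] by simp
  have lim_l: "(\<lambda>n. ln (r n)) \<longlonglongrightarrow> ls"
  proof -
    have "ln \<longlonglongrightarrow> ls + 0"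
      unfolding ln_def[abs_def] using LIMSEQ_inverse_real_of_nat
      by (intro tendsto_add tendsto_const) (simp add: inverse_eq_divide add.commute)
    then show ?thesis using LIMSEQ_subseq_LIMSEQ[OF _ r] by (simp add: o_def)
  qed
  \<comment> \<open>The violating component \<open>js n\<close> varies with n. If no component were
    in contact in the limit, the finitely many strict inequalities would eventually hold together,
    also for \<open>js n\<close>.\<close>
  have "\<exists>i. w1 (x, \<sigma>) $ i + c + \<eta> * \<sigma> \<le> ls * (w1 (x, 0) $ i + c)"
  proof (rule ccontr)
    assume "\<not> ?thesis"
    then have neg: "0 < w1 (x, \<sigma>) $ i + c + \<eta> * \<sigma> - ls * (w1 (x, 0) $ i + c)" for i
      by (simp add: not_le)
    have "\<forall>\<^sub>F n in sequentially. 0 < f (ys (r n), ss (r n)) $ i + c + \<eta> * (ss (r n) - ts (r n))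
        - ln (r n) * (f (ys (r n), ts (r n)) $ i + c)" for i
      by (rule order_tendstoD(1)[OF _ neg[of i]])
         (intro tendsto_intros tendsto_vec_nth lim_s lim_t lim_d lim_l)
    then have "\<forall>\<^sub>F n in sequentially. \<forall>i. 0 < f (ys (r n), ss (r n)) $ i + c + \<eta> * (ss (r n) - ts (r n))
        - ln (r n) * (f (ys (r n), ts (r n)) $ i + c)"
      by (rule eventually_all_finite)
    then have "\<forall>\<^sub>F n in sequentially. False"
    proof eventually_elim
      case (elim n)
      then show ?case using ys(2)[of "r n"] by (auto dest: spec[of _ "js (r n)"])
    qed
    then show False by simp
  qed
  then obtain i0 where contact: "w1 (x, \<sigma>) $ i0 + c + \<eta> * \<sigma> \<le> ls * (w1 (x, 0) $ i0 + c)"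
    by blast
  show False
  proof (rule no_contact[OF w ls \<eta> _ _ _ contact])
    show "B + 1 \<le> c" by (simp add: c_def)
    show "0 \<le> \<sigma>" using z0 by (simp add: x\<sigma>)
    fix x t s i assume "t \<le> (s :: real)"
    \<comment> \<open>The supremum need not be good itself. The inequality is passed to w1 for every
      smaller constant, and only afterwards do these constants tend to \<open>ls\<close>.\<close>
    have le: "l' * (w1 (x, t) $ i + c) \<le> w1 (x, s) $ i + c + \<eta> * (s - t)" if "l' < ls" for l'
    proof -
      have "\<exists>l''\<in>Collect good. l' < l''"
        using that good_0 unfolding ls_def by (intro less_cSupD) auto
      then obtain l'' where "good l''" "l' < l''" by auto
      then have "good l'" using good_mono by (meson less_imp_le)
      then obtain N where N: "\<And>t s x i. N \<le> t \<Longrightarrow> t \<le> s \<Longrightarrow>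
          l' * (f (x, t) $ i + c) \<le> f (x, s) $ i + c + \<eta> * (s - t)"
        unfolding good_def eventually_at_top_linorder by blast
      have "\<forall>\<^sub>F n in sequentially. N - t \<le> (ts \<circ> r) n"
        using w by (auto simp: omega_limit_def filterlim_at_top)
      then have "\<forall>\<^sub>F n in sequentially. l' * (f ((x, t) + (0, (ts \<circ> r) n)) $ i + c)
          \<le> f ((x, s) + (0, (ts \<circ> r) n)) $ i + c + \<eta> * (s - t)"
      proof eventually_elim
        case (elim n)
        then show ?case using N[of "t + ts (r n)" "s + ts (r n)" x i] \<open>t \<le> s\<close> by simp
      qed
      then show ?thesis
        by (rule tendsto_le[OF sequentially_bot _ _, rotated 2])
           (intro tendsto_intros tendsto_vec_nth omega_limit_tendsto[OF w])+
    qed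
    have "(\<lambda>n. ls - 1 / (real n + 1)) \<longlonglongrightarrow> ls - 0"
      using LIMSEQ_inverse_real_of_nat
      by (intro tendsto_diff tendsto_const) (simp add: inverse_eq_divide add.commute)
    then have "(\<lambda>n. (ls - 1 / (real n + 1)) * (w1 (x, t) $ i + c)) \<longlonglongrightarrow> ls * (w1 (x, t) $ i + c)"
      by (intro tendsto_intros) simp
    then show "ls * (w1 (x, t) $ i + c) \<le> w1 (x, s) $ i + c + \<eta> * (s - t)"
      by (rule LIMSEQ_le_const2) (intro exI allI impI le, simp)
  qed
qed

section \<open>Monotonicity in time and convergence\<close>

lemma omega_limit_mono:
  assumes w: "omega_limit ts w" and "t \<le> s"
  shows "w (x, t) $ i \<le> w (x, s) $ i"
proof -
  let ?e = "\<lambda>n. 1 / (real n + 1)"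
  \<comment> \<open>The ratio tends to 1 and \<eta> to 0 simultaneously, both governed by
    \<open>1 / (k + 1)\<close>; in the limit the shift by \<open>B + 1\<close> cancels.\<close>
  have le: "(1 - ?e k) * (w (x, t) $ i + (B + 1)) \<le> w (x, s) $ i + (B + 1) + ?e k * (s - t)" for k
  proof -
    have "\<forall>\<^sub>F t in at_top. \<forall>s\<ge>t. \<forall>x i.
        (1 - ?e k) * (f (x, t) $ i + (B + 1)) \<le> f (x, s) $ i + (B + 1) + ?e k * (s - t)"
      by (rule asymptotic_ratio) auto
    then obtain N where N: "\<And>t s x i. N \<le> t \<Longrightarrow> t \<le> s \<Longrightarrow>
        (1 - ?e k) * (f (x, t) $ i + (B + 1)) \<le> f (x, s) $ i + (B + 1) + ?e k * (s - t)"
      unfolding eventually_at_top_linorder by blast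
    have "\<forall>\<^sub>F n in sequentially. N - t \<le> ts n"
      using w by (auto simp: omega_limit_def filterlim_at_top)
    then have "\<forall>\<^sub>F n in sequentially. (1 - ?e k) * (f ((x, t) + (0, ts n)) $ i + (B + 1))
        \<le> f ((x, s) + (0, ts n)) $ i + (B + 1) + ?e k * (s - t)"
    proof eventually_elim
      case (elim n)
      then show ?case using N[of "t + ts n" "s + ts n" x i] \<open>t \<le> s\<close> by simp
    qed
    then show ?thesis
      by (rule tendsto_le[OF sequentially_bot _ _, rotated 2])
         (intro tendsto_intros tendsto_vec_nth omega_limit_tendsto[OF w])+
  qed
  have e: "?e \<longlonglongrightarrow> 0"
    using LIMSEQ_inverse_real_of_nat by (simp add: inverse_eq_divide add.commute)
  have "(1 - 0) * (w (x, t) $ i + (B + 1)) \<le> w (x, s) $ i + (B + 1) + 0 * (s - t)"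
  proof (rule LIMSEQ_le)
    show "(\<lambda>n. (1 - ?e n) * (w (x, t) $ i + (B + 1))) \<longlonglongrightarrow> (1 - 0) * (w (x, t) $ i + (B + 1))"
      by (intro tendsto_intros e)
    show "(\<lambda>n. w (x, s) $ i + (B + 1) + ?e n * (s - t)) \<longlonglongrightarrow> w (x, s) $ i + (B + 1) + 0 * (s - t)"
      by (intro tendsto_intros e)
  qed (use le in blast)
  then show ?thesis by simp
qed

text \<open>Compactness yields a limit along one subsequence of times only. Comparison upgrades it:
  once f is componentwise within d of the stationary solution v at a single time, it stays so at all
  later times.\<close>

lemma converges_to_stationary:
  obtains v where "stationary_solution H D v" "uniform_limit UNIV (\<lambda>t x. f (x, t)) v at_top"
proof -
  obtain r w where w: "omega_limit (real \<circ> r) w"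
    using omega_limit_exists[OF filterlim_real_sequentially] by blast
  have wb: "- B \<le> w z $ i" "w z $ i \<le> B" for z i
    using bound_component[of w, OF omega_limit_bound[OF w]] by auto
  define v where "v x = (\<chi> i. SUP t. w (x, t) $ i)" for x
  have v_lim: "((\<lambda>t. w (x, t) $ i) \<longlongrightarrow> v x $ i) at_top" for x i
  proof (rule increasing_tendsto)
    have bdd: "bdd_above (range (\<lambda>t. w (x, t) $ i))" using wb by (auto intro: bdd_aboveI[of _ B])
    show "\<forall>\<^sub>F t in at_top. w (x, t) $ i \<le> v x $ i"
      by (intro always_eventually allI) (simp add: v_def cSUP_upper[OF _ bdd])
    fix y assume "y < v x $ i"
    then obtain t where "y < w (x, t) $ i"
      using less_cSupD[of "range (\<lambda>t. w (x, t) $ i)" y] by (auto simp: v_def)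
    then have "y < w (x, s) $ i" if "t \<le> s" for s
      using omega_limit_mono[OF w that, of x i] by simp
    then show "\<forall>\<^sub>F s in at_top. y < w (x, s) $ i"
      unfolding eventually_at_top_linorder by blast
  qed
  \<comment> \<open>Read on space-time, v is the limit of the translates of w by n. The limit
    theorems then show directly that it solves the evolution system, and it does not depend on
    time.\<close>
  have v_lim': "(\<lambda>n. w (z + (0, real n))) \<longlonglongrightarrow> v (fst z)" for z
  proof (rule vec_tendstoI)
    fix i
    have "filterlim (\<lambda>n. snd z + real n) at_top sequentially"
      by (rule filterlim_tendsto_add_at_top[OF tendsto_const filterlim_real_sequentially])
    from filterlim_compose[OF v_lim[of "fst z" i] this]
    show "(\<lambda>n. w (z + (0, real n)) $ i) \<longlonglongrightarrow> v (fst z) $ i"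
      by (simp add: plus_prod_def)
  qed
  have w_lip: "L-lipschitz_on UNIV (\<lambda>z. w (z + (0, T)))" for T
  proof (rule lipschitz_onI)
    show "dist (w (x + (0, T))) (w (y + (0, T))) \<le> L * dist x y" for x y
      using lipschitz_onD[OF omega_limit_lipschitz[OF w], of "x + (0, T)" "y + (0, T)"] by simp
  qed (rule lipschitz_on_nonneg[OF lip])
  have v_lip: "L-lipschitz_on UNIV (\<lambda>z :: (real^'n) \<times> real. v (fst z))"
    using w_lip v_lim' by (rule lipschitz_on_limit)
  have v_sub: "viscosity_subsolution UNIV (evolution_op H D) (\<lambda>z. v (fst z))"
    using continuous_on_evolution_op[OF H_cont] w_lip v_lim'
  proof (rule viscosity_subsolution_limit)
    show "viscosity_subsolution UNIV (evolution_op H D) (\<lambda>z. w (z + (0, real n)))" for n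
    proof -
      have "viscosity_subsolution {z. z + (0, real n) \<in> UNIV} (evolution_op H D) (\<lambda>z. w (z + (0, real n)))"
        by (rule viscosity_subsolution_translate[OF _ omega_limit_sub[OF w]]) (simp add: case_prod_beta)
      then show ?thesis by simp
    qed
  qed (rule exI[of _ 1], simp)
  have v_sup: "viscosity_supersolution UNIV (evolution_op H D) (\<lambda>z. v (fst z))"
    using continuous_on_evolution_op[OF H_cont] w_lip v_lim'
  proof (rule viscosity_supersolution_limit)
    show "viscosity_supersolution UNIV (evolution_op H D) (\<lambda>z. w (z + (0, real n)))" for n
    proof -
      have "viscosity_supersolution {z. z + (0, real n) \<in> UNIV} (evolution_op H D) (\<lambda>z. w (z + (0, real n)))"
        by (rule viscosity_supersolution_translate[OF _ omega_limit_sup[OF w]]) (simp add: case_prod_beta)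
      then show ?thesis by simp
    qed
  qed (rule exI[of _ 1], simp)
  have v_per: "periodic v"
    by (rule periodic_limit[where F = "\<lambda>n x. w (x, real n)"])
       (use omega_limit_periodic[OF w] v_lim'[of "(_, 0)"] in auto)
  have slice: "L-lipschitz_on UNIV (\<lambda>x. g (x, t))"
    if "L-lipschitz_on UNIV g" for g :: "(real^'n) \<times> real \<Rightarrow> real^'m" and t
  proof (rule lipschitz_onI)
    show "dist (g (x, t)) (g (y, t)) \<le> L * dist x y" for x y
      using lipschitz_onD[OF that, of "(x, t)" "(y, t)"] by (simp add: dist_Pair_Pair)
  qed (rule lipschitz_on_nonneg[OF that])
  have "stationary_solution H D v"
    using v_per lipschitz_on_continuous_on[OF slice[OF v_lip]] v_sub v_sup
    by (intro stationary_solution_if_evolution) auto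
  moreover have "uniform_limit UNIV (\<lambda>t x. f (x, t)) v at_top"
  proof (rule uniform_limitI)
    fix e :: real assume "e > 0"
    \<comment> \<open>Bounding the norm by the sum of the components costs a factor
      \<open>CARD('m)\<close>; the 2 makes the final inequality strict.\<close>
    define d where "d = e / (2 * real CARD('m))"
    have d: "d > 0" "real CARD('m) * d < e" using \<open>e > 0\<close> by (auto simp: d_def)
    have "uniform_limit UNIV (\<lambda>n x. w (x, real n)) v sequentially"
      by (rule periodic_uniform_limit[OF slice[OF omega_limit_lipschitz[OF w]] omega_limit_periodic[OF w]])
         (use v_lim'[of "(_, 0)"] in auto)
    then have "\<forall>\<^sub>F n in sequentially. \<forall>x\<in>UNIV. dist (w (x, real n)) (v x) < d / 2"
      by (rule uniform_limitD) (use d in simp)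
    then obtain k where k: "\<And>x. dist (w (x, real k)) (v x) < d / 2"
      using eventually_happens'[OF sequentially_bot] by blast
    have "uniform_limit UNIV (\<lambda>n x. f (x, real k + real (r n))) (\<lambda>x. w (x, real k)) sequentially"
      by (rule periodic_uniform_limit[OF slice[OF lip] per])
         (use omega_limit_tendsto[OF w, of "(_, real k)"] in auto)
    then have "\<forall>\<^sub>F n in sequentially. \<forall>x\<in>UNIV. dist (f (x, real k + real (r n))) (w (x, real k)) < d / 2"
      by (rule uniform_limitD) (use d in simp)
    moreover have "\<forall>\<^sub>F n in sequentially. a0 + 1 \<le> real (r n)"
      using w by (auto simp: omega_limit_def filterlim_at_top)
    ultimately have "\<forall>\<^sub>F n in sequentially. (\<forall>x\<in>UNIV. dist (f (x, real k + real (r n))) (w (x, real k)) < d / 2)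
        \<and> a0 + 1 \<le> real (r n)"
      by (rule eventually_conj)
    then obtain n where n: "\<And>x. dist (f (x, real k + real (r n))) (w (x, real k)) < d / 2"
      "a0 + 1 \<le> real (r n)"
      using eventually_happens'[OF sequentially_bot] by blast
    \<comment> \<open>At this time f is close to w at time k, which in turn is close to v, each
      within \<open>d / 2\<close>.\<close>
    define T where "T = real k + real (r n)"
    have T: "a0 < T" using n(2) by (simp add: T_def)
    have close: "\<bar>f (x, T) $ i - v x $ i\<bar> \<le> d" for x i
      using n(1)[of x] k[of x] dist_triangle[of "f (x, T)" "v x" "w (x, real k)"]
        component_le_norm_cart[of "f (x, T) - v x" i]
      by (simp add: T_def dist_norm)
    have v_bound: "norm (v x) \<le> B" for x
      using omega_limit_bound[OF w] by (intro LIMSEQ_le_const2[OF tendsto_norm[OF v_lim'[of "(x, 0)", simplified]]]) auto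
    have sub_r: "viscosity_subsolution (UNIV \<times> {a0<..}) (evolution_op H D) (\<lambda>z. v (fst z))"
      and sup_r: "viscosity_supersolution (UNIV \<times> {a0<..}) (evolution_op H D) (\<lambda>z. v (fst z))"
      using viscosity_subsolution_subset[OF v_sub] viscosity_supersolution_subset[OF v_sup] by auto
    have cmp: "\<bar>f (x, t) $ i - v x $ i\<bar> \<le> d" if "T \<le> t" for x t i
    proof -
      have "f (x, t) $ i - v (fst (x, t)) $ i \<le> d"
        by (rule comparison_stationary[OF H_cont D(1) sub lip per bound sup_r v_lip _ _ _ T _ that])
           (use v_per v_bound close in \<open>auto simp: abs_le_iff\<close>)
      moreover have "v (fst (x, t)) $ i - f (x, t) $ i \<le> d"
        by (rule comparison_stationary[OF H_cont D(1) sub_r v_lip _ _ sup lip per bound _ T _ that])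
           (use v_per v_bound close in \<open>auto simp: abs_le_iff\<close>)
      ultimately show ?thesis by simp
    qed
    have "dist (f (x, t)) (v x) < e" if "T \<le> t" for x t
    proof -
      have "norm (f (x, t) - v x) \<le> (\<Sum>i\<in>UNIV. \<bar>(f (x, t) - v x) $ i\<bar>)"
        by (rule norm_le_l1_cart)
      also have "\<dots> \<le> (\<Sum>i\<in>(UNIV :: 'm set). d)"
        using cmp[OF that] by (intro sum_mono) simp
      finally show ?thesis using d(2) by (simp add: dist_norm)
    qed
    then show "\<forall>\<^sub>F t in at_top. \<forall>x\<in>UNIV. dist (f (x, t)) (v x) < e"
      unfolding eventually_at_top_linorder by blast
  qed
  ultimately show ?thesis using that by blast
qed

end

section \<open>Reduction of the theorem to solutions defined for all times\<close>

theorem theorem1p1: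
  fixes D :: "real^'m^'m"
    and H :: "'m \<Rightarrow> real^'n \<Rightarrow> real^'n \<Rightarrow> real"
    and u0 :: "real^'n \<Rightarrow> real^'m"
    and u :: "(real^'n) \<times> real \<Rightarrow> real^'m"
    and v :: "real^'n \<Rightarrow> real^'m"
    and K :: "(real^'n) set"
    and \<psi> :: "real \<Rightarrow> real"
  assumes "monotone_matrix D"
    and "irreducible_matrix D"
    and "\<exists>i. \<forall>j. D $ i $ j \<noteq> 0"
    and "\<And>i. continuous_on UNIV (\<lambda>(x, p). H i x p)"
    and "\<And>i p. periodic (\<lambda>x. H i x p)"
    and "\<And>i. continuous_on UNIV (\<lambda>x. u0 x $ i)"
    and "\<And>i. periodic (\<lambda>x. u0 x $ i)"
    and "evolution_solution H D u0 u"
    and unique: "\<And>w. evolution_solution H D u0 w \<Longrightarrow> \<forall>x. \<forall>t\<ge>0. w (x, t) = u (x, t)"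
    and "\<And>i. W1_inf_on (UNIV \<times> {0<..}) (\<lambda>z. u z $ i)"
    and "stationary_solution H D v"
    and "\<And>i. W1_inf_on UNIV (\<lambda>x. v x $ i)"
    and "torus_compact K"
    and "\<And>\<eta>. \<eta> > 0 \<Longrightarrow> \<psi> \<eta> > 0"
    and i: "\<And>i. AE x in lebesgue. \<forall>p. H i x differentiable (at p)"
    and ii: "\<And>i. AE (x, p) in lebesgue. \<exists>q. (GDERIV (H i x) p :> q) \<and> q \<bullet> p - H i x p \<ge> 0"
    and iii_a: "\<And>i x p. x \<in> K \<Longrightarrow> H i x p \<ge> 0"
    and iii_b: "\<And>i x p q \<eta>. \<eta> > 0 \<Longrightarrow> H i x p \<ge> \<eta> \<Longrightarrow> set_dist x K \<ge> ereal \<eta> \<Longrightarrow>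
      GDERIV (H i x) p :> q \<Longrightarrow> q \<bullet> p - H i x p \<ge> \<psi> \<eta>"
  shows "\<exists>v_inf. stationary_solution H D v_inf \<and>
           uniform_limit UNIV (\<lambda>t x. u (x, t)) v_inf at_top"
proof -
  \<comment> \<open>The Lipschitz bound on u concerns positive times only. Freezing u before time 1
    gives a function on all of space-time with the same componentwise bounds, since
    \<open>max\<close> is nonexpansive; it solves the system after time 1, whence
    \<open>a0 = 1\<close>.\<close>
  define f where "f = (\<lambda>z :: (real^'n) \<times> real. u (fst z, max (snd z) 1))"
  have per_u: "periodic (\<lambda>x. u (x, t))" if "0 \<le> t" for t
    using assms(8) that by (simp add: evolution_solution_def)
  have visc: "viscosity_subsolution (UNIV \<times> {0<..}) (evolution_op H D) u"
    "viscosity_supersolution (UNIV \<times> {0<..}) (evolution_op H D) u"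
    using assms(8) by (simp_all add: evolution_solution_def viscosity_solution_def)
  have f_eq: "f z = u z" if "z \<in> UNIV \<times> {1<..}" for z
    using that by (auto simp: f_def max_def)
  have "\<exists>B. \<forall>z\<in>UNIV \<times> {0<..}. \<bar>u z $ i\<bar> \<le> B" for i
    using assms(10)[of i] by (auto simp: W1_inf_on_def bounded_iff)
  then obtain b where b: "\<And>i z. z \<in> UNIV \<times> {0<..} \<Longrightarrow> \<bar>u z $ i\<bar> \<le> b i"
    by metis
  have "\<exists>L. L-lipschitz_on (UNIV \<times> {0<..}) (\<lambda>z. u z $ i)" for i
    using assms(10)[of i] by (auto simp: W1_inf_on_def)
  then obtain l where l: "\<And>i. (l i)-lipschitz_on (UNIV \<times> {0<..}) (\<lambda>z. u z $ i)"
    by metis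
  \<comment> \<open>The constants are sums over the components because the Euclidean norm is
    estimated by the sum of absolute values.\<close>
  interpret weakly_coupled_evolution D H K f "\<Sum>i\<in>UNIV. l i" "\<Sum>i\<in>UNIV. b i" 1
  proof
    show hom: "c * H i x p \<le> H i x (c *\<^sub>R p)" if "1 \<le> c" for i x p c
      by (rule hamiltonian_superhomogeneous[OF assms(4) i ii that])
    show "c * H i x p < H i x (c *\<^sub>R p)" if "x \<notin> K" "0 < H i x p" "1 < c" for i x p c
    proof (rule hamiltonian_strictly_superhomogeneous[OF assms(4) i hom, where K = K and \<psi> = \<psi>])
      show "\<psi> \<eta> \<le> q \<bullet> p - H i x p"
        if "\<eta> > 0" "\<eta> \<le> H i x p" "ereal \<eta> \<le> set_dist x K" "GDERIV (H i x) p :> q" for x p q \<eta>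
        using that by (rule iii_b)
      show "closed K" using assms(13) by (simp add: torus_compact_def)
    qed (use assms(14) that in auto)
    show "(\<Sum>i\<in>UNIV. l i)-lipschitz_on UNIV f"
    proof (rule lipschitz_onI)
      show "0 \<le> (\<Sum>i\<in>UNIV. l i)"
        by (intro sum_nonneg lipschitz_on_nonneg[OF l])
      fix y z :: "(real^'n) \<times> real"
      let ?c = "\<lambda>z :: (real^'n) \<times> real. (fst z, max (snd z) 1)"
      have "dist (max (snd y) 1) (max (snd z) 1) \<le> dist (snd y) (snd z)"
        by (auto simp: dist_real_def)
      then have c: "dist (?c y) (?c z) \<le> dist y z"
        unfolding dist_prod_def by (auto intro!: real_sqrt_le_mono add_mono power_mono)
      have "norm (f y - f z) \<le> (\<Sum>i\<in>UNIV. \<bar>(f y - f z) $ i\<bar>)"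
        by (rule norm_le_l1_cart)
      also have "\<dots> \<le> (\<Sum>i\<in>UNIV. l i * dist y z)"
      proof (rule sum_mono)
        fix i
        have "\<bar>(f y - f z) $ i\<bar> \<le> l i * dist (?c y) (?c z)"
          using lipschitz_onD[OF l, of "?c y" "?c z" i] by (simp add: f_def dist_real_def)
        also have "\<dots> \<le> l i * dist y z"
          using c by (intro mult_left_mono lipschitz_on_nonneg[OF l])
        finally show "\<bar>(f y - f z) $ i\<bar> \<le> l i * dist y z" .
      qed
      finally show "dist (f y) (f z) \<le> (\<Sum>i\<in>UNIV. l i) * dist y z"
        by (simp add: dist_norm sum_distrib_right)
    qed
    show "norm (f z) \<le> (\<Sum>i\<in>UNIV. b i)" for z
    proof -
      have "norm (f z) \<le> (\<Sum>i\<in>UNIV. \<bar>f z $ i\<bar>)" by (rule norm_le_l1_cart)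
      also have "\<dots> \<le> (\<Sum>i\<in>UNIV. b i)"
        unfolding f_def by (intro sum_mono b) auto
      finally show ?thesis .
    qed
    show "periodic (\<lambda>x. f (x, t))" for t
      using per_u[of "max t 1"] by (simp add: f_def)
    show "viscosity_subsolution (UNIV \<times> {1<..}) (evolution_op H D) f"
    proof (rule viscosity_subsolution_cong[OF _ f_eq])
      show "viscosity_subsolution (UNIV \<times> {1<..}) (evolution_op H D) u"
        by (rule viscosity_subsolution_subset[OF visc(1)]) auto
    qed
    show "viscosity_supersolution (UNIV \<times> {1<..}) (evolution_op H D) f"
    proof (rule viscosity_supersolution_cong[OF _ f_eq])
      show "viscosity_supersolution (UNIV \<times> {1<..}) (evolution_op H D) u"
        by (rule viscosity_supersolution_subset[OF visc(2)]) auto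
    qed
  qed (use assms(1,2,4) iii_a in auto)
  obtain v_inf where v_inf: "stationary_solution H D v_inf"
    "uniform_limit UNIV (\<lambda>t x. f (x, t)) v_inf at_top"
    using converges_to_stationary by blast
  have "\<forall>\<^sub>F t in at_top. \<forall>x\<in>UNIV. f (x, t) = u (x, t)"
    using eventually_ge_at_top[of 1] by eventually_elim (auto simp: f_def max_def)
  from uniform_limit_cong[OF this, of v_inf v_inf] v_inf(2)
  have "uniform_limit UNIV (\<lambda>t x. u (x, t)) v_inf at_top"
    by simp
  with v_inf(1) show ?thesis by blast
qed

end
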